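(* Let $q=2^s$ with $s\ge 2$ and let $m$ be odd. Let $n=q^m-1$ and let $\beta$ be a primitive $n$-th root of unity in $\mathbb{F}_{q^m}$. Put $\delta=q^{\frac{m+1}{2}}-2q+1$ and assume $\delta\ge 2$. Let $g(x)$ be the generator polynomial of the BCH code $\mathcal{C}_{(q,n,\delta,1,\beta)}$, let $h(x)=(x^n-1)/g(x)$, and let $g^\perp(x)=x^{\deg h(x)}h(x^{-1})/h(0)$ be the generator polynomial of the Euclidean dual $\mathcal{C}_{(q,n,\delta,1,\beta)}^\perp$. Let $\mathcal{C}'$ denote the cyclic code of length $2n$ over $\mathbb{F}_q$ with generator polynomial $g(x)g^\perp(x)$. Then $\mathcal{C}'$ is a Euclidean self-dual cyclic code with parameters $[2n,n,d]_q$, where (i) if $m\ge 5$, then $d=\min\{2d(\mathcal{C}_{(q,n,\delta,1,\beta)}),\,d(\mathcal{C}_{(q,n,\delta,1,\beta)}^\perp)\}\ge q^{\frac{m+1}{2}}+3$; (ii) if $q\ge 8$ and $m=3$, then $d=\min\{2d(\mathcal{C}_{(q,n,\delta,1,\beta)}),\,d(\mathcal{C}_{(q,n,\delta,1,\beta)}^\perp)\}\ge q^2+4$.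
   Context: An $[n,k,d]_q$ code is a $k$-dimensional linear subspace of $\mathbb{F}_q^n$ with minimum Hamming distance $d$; $d(\mathcal{C})$ denotes the minimum Hamming distance of $\mathcal{C}$. The Euclidean dual is $\mathcal{C}^\perp=\{c\in\mathbb{F}_q^n:\sum_i c_iy_i=0\ \forall y\in\mathcal{C}\}$; $\mathcal{C}$ is Euclidean self-dual if $\mathcal{C}=\mathcal{C}^\perp$. A cyclic code of length $N$ over $\mathbb{F}_q$ is identified with an ideal of $\mathbb{F}_q[x]/\langle x^N-1\rangle$ via $(c_0,\dots,c_{N-1})\mapsto c_0+c_1x+\dots+c_{N-1}x^{N-1}$; its generator polynomial is the unique monic divisor of $x^N-1$ generating it. For $\gcd(n,q)=1$ and $\beta$ a primitive $n$-th root of unity, $m_{\beta^i}(x)$ denotes the minimal polynomial of $\beta^i$ over $\mathbb{F}_q$. For integers $\delta\ge2$ and $b$, the BCH code $\mathcal{C}_{(q,n,\delta,b,\beta)}$ is the cyclic code of length $n$ over $\mathbb{F}_q$ with generator polynomial $\mathrm{lcm}\{m_{\beta^b}(x),\dots,m_{\beta^{b+\delta-2}}(x)\}$. *)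

theory Defs
  imports
    "Jordan_Normal_Form.VS_Connect"
    "HOL-Computational_Algebra.Polynomial_Factorial"
    "HOL-Algebra.QuotRing"
begin

definition hamming_dist :: "'a vec \<Rightarrow> 'a vec \<Rightarrow> nat" where
  "hamming_dist u v = card {i. i < dim_vec u \<and> u $ i \<noteq> v $ i}"

text \<open>The value is only meaningful for codes with at least two words; otherwise it is
  the infimum of the empty set, i.e. \<open>0\<close>.\<close>

definition min_dist :: "'a vec set \<Rightarrow> nat" where
  "min_dist C = Inf {hamming_dist u v | u v. u \<in> C \<and> v \<in> C \<and> u \<noteq> v}"

definition linear_code :: "nat \<Rightarrow> nat \<Rightarrow> nat \<Rightarrow> 'a :: field vec set \<Rightarrow> bool" where
  "linear_code N k d C \<longleftrightarrow>
     VectorSpace.subspace (class_ring :: 'a ring) C (module_vec TYPE('a) N) \<and>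
     vectorspace.dim (class_ring :: 'a ring) ((module_vec TYPE('a) N)\<lparr>carrier := C\<rparr>) = k \<and>
     min_dist C = d"

definition dual_code :: "nat \<Rightarrow> 'a :: field vec set \<Rightarrow> 'a vec set" where
  "dual_code N C = {c \<in> carrier_vec N. \<forall>y \<in> C. c \<bullet> y = 0}"

definition self_dual :: "nat \<Rightarrow> 'a :: field vec set \<Rightarrow> bool" where
  "self_dual N C \<longleftrightarrow> C = dual_code N C"

abbreviation xpow_minus_one :: "nat \<Rightarrow> 'a :: field poly" where
  "xpow_minus_one N \<equiv> monom 1 N - 1"

definition cyclic_ring :: "nat \<Rightarrow> 'a :: field poly set ring" where
  "cyclic_ring N =
     (class_ring :: 'a poly ring) Quot (PIdl\<^bsub>class_ring :: 'a poly ring\<^esub> (xpow_minus_one N))"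

definition residue_class :: "nat \<Rightarrow> 'a :: field poly \<Rightarrow> 'a poly set" where
  "residue_class N p =
     PIdl\<^bsub>class_ring :: 'a poly ring\<^esub> (xpow_minus_one N) +>\<^bsub>class_ring :: 'a poly ring\<^esub> p"

text \<open>\<open>Poly (list_of_vec c)\<close> is \<open>c\<^sub>0 + c\<^sub>1 x + \<dots>\<close>, with the constant coefficient first.\<close>

definition code_class :: "nat \<Rightarrow> 'a :: field vec \<Rightarrow> 'a poly set" where
  "code_class N c = residue_class N (Poly (list_of_vec c))"

definition cyclic_code :: "nat \<Rightarrow> 'a :: field vec set \<Rightarrow> bool" where
  "cyclic_code N C \<longleftrightarrow> C \<subseteq> carrier_vec N \<and> ideal (code_class N ` C) (cyclic_ring N)"

definition is_generator_poly :: "nat \<Rightarrow> 'a :: field vec set \<Rightarrow> 'a poly \<Rightarrow> bool" where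
  "is_generator_poly N C g \<longleftrightarrow>
     cyclic_code N C \<and> lead_coeff g = 1 \<and> g dvd xpow_minus_one N \<and>
     code_class N ` C = PIdl\<^bsub>cyclic_ring N\<^esub> (residue_class N g)"

definition generator_poly :: "nat \<Rightarrow> 'a :: field vec set \<Rightarrow> 'a poly" where
  "generator_poly N C = (THE g. is_generator_poly N C g)"

definition cyclic_code_of :: "nat \<Rightarrow> 'a :: field poly \<Rightarrow> 'a vec set" where
  "cyclic_code_of N g =
     {c \<in> carrier_vec N. code_class N c \<in> PIdl\<^bsub>cyclic_ring N\<^esub> (residue_class N g)}"

definition is_primitive_root :: "nat \<Rightarrow> 'b :: field \<Rightarrow> bool" where
  "is_primitive_root n \<beta> \<longleftrightarrow> n > 0 \<and> \<beta> ^ n = 1 \<and> (\<forall>k. 0 < k \<and> k < n \<longrightarrow> \<beta> ^ k \<noteq> 1)"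

text \<open>The field extension is given by an embedding \<open>emb\<close> of the ground field.\<close>

definition minimal_poly :: "('a :: field \<Rightarrow> 'b :: field) \<Rightarrow> 'b \<Rightarrow> 'a poly" where
  "minimal_poly emb x = (THE p. lead_coeff p = 1 \<and> poly (map_poly emb p) x = 0 \<and>
     (\<forall>r. r \<noteq> 0 \<and> poly (map_poly emb r) x = 0 \<longrightarrow> degree p \<le> degree r))"

text \<open>On polynomials over a field, \<^const>\<open>Lcm\<close> of a finite set of nonzero polynomials is the
  monic least common multiple. It requires the ground field to be of class
  \<^class>\<open>field_gcd\<close>, whose additional operations exist, and are trivial, on every field.\<close>

definition bch_code ::
    "('a :: field_gcd \<Rightarrow> 'b :: field) \<Rightarrow> nat \<Rightarrow> int \<Rightarrow> int \<Rightarrow> 'b \<Rightarrow> 'a vec set" where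
  "bch_code emb n \<delta> b \<beta> =
     cyclic_code_of n (Lcm ((\<lambda>i. minimal_poly emb (\<beta> powi i)) ` {b..b + \<delta> - 2}))"

end

theory Submission
  imports Defs "Jordan_Normal_Form.Char_Poly"
begin

text \<open>
  Reordering positions by parity identifies the code \<open>C'\<close> of length \<open>2n\<close> with \<open>{(u | u + v)}\<close> for
  \<open>u \<in> C\<close> and \<open>v\<close> in the dual of \<open>C\<close>. This uses that the dual is contained in \<open>C\<close>, and it gives the
  formula for the minimum distance. Self-duality is a computation with reciprocal polynomials, and \<open>C\<close> is handled by
  the BCH bound.

  For the dual, put \<open>Q = q\<^bsup>(m+1)/2\<^esup>\<close>. Its zeros include \<open>\<beta>\<^sup>i\<close> for two runs of exponents of length \<open>L\<close>,
  starting at \<open>0\<close> and at \<open>Q\<close>, where \<open>L = Q - q + 1\<close>, and \<open>L = Q - q + 2\<close> if \<open>m = 3\<close>. A codeword of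
  weight \<open>w = L + 1 + t\<close> then produces a relation \<open>x\<^sup>Q p1(x) = p2(x)\<close> with polynomials of degree at most \<open>t\<close>,
  valid at its \<open>w\<close> locators. Since \<open>x\<close> lies in the field with \<open>q\<^sup>m\<close> elements, raising it to the power \<open>q\<^bsup>(m-1)/2\<^esup>\<close> replaces
  \<open>x\<^sup>Q\<close> by \<open>x\<close>. Counting roots gives \<open>w \<le> t q\<^bsup>(m-1)/2\<^esup> + 1\<close>, which forces \<open>t > q\<close>.
\<close>

section \<open>Cyclic codes as sets of multiples of a generator polynomial\<close>

lemma mem_residue_class:
  "x \<in> residue_class N p \<longleftrightarrow> xpow_minus_one N dvd x - p" for p :: "'a :: field poly"
proof -
  have "x \<in> residue_class N p \<longleftrightarrow> (\<exists>k. x = k * xpow_minus_one N + p)"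
    unfolding residue_class_def a_r_coset_def' cgenideal_def by auto
  also have "\<dots> \<longleftrightarrow> xpow_minus_one N dvd x - p"
    unfolding dvd_def by (metis add_diff_cancel diff_add_cancel mult.commute)
  finally show ?thesis .
qed

lemma residue_class_eq_iff:
  "residue_class N p = residue_class N r \<longleftrightarrow> xpow_minus_one N dvd p - r" for p :: "'a :: field poly"
proof
  assume "residue_class N p = residue_class N r"
  then have "p \<in> residue_class N r" using mem_residue_class[of p N p] by simp
  then show "xpow_minus_one N dvd p - r" by (simp add: mem_residue_class)
next
  assume *: "xpow_minus_one N dvd p - r"
  have "xpow_minus_one N dvd x - p \<longleftrightarrow> xpow_minus_one N dvd x - r" for x
    using dvd_add[OF _ *, of "x - p"] dvd_diff[OF _ *, of "x - r"] by auto
  then show "residue_class N p = residue_class N r"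
    by (auto simp: mem_residue_class)
qed

lemma cyclic_ring_ideal:
  "ideal (PIdl\<^bsub>class_ring\<^esub> (xpow_minus_one N :: 'a :: field poly)) class_ring"
  by (rule cring.cgenideal_ideal) (use class_cring.cring_axioms in auto)

lemma residue_class_hom:
  "residue_class N \<in> Ring.ring_hom (class_ring :: 'a :: field poly ring) (cyclic_ring N)"
  unfolding residue_class_def[abs_def] cyclic_ring_def
  by (rule ideal.rcos_ring_hom[OF cyclic_ring_ideal])

lemma cring_cyclic_ring: "cring (cyclic_ring N :: 'a :: field poly set ring)"
  unfolding cyclic_ring_def
  by (rule ideal.quotient_is_cring[OF cyclic_ring_ideal class_cring.cring_axioms])

lemma carrier_cyclic_ring: "carrier (cyclic_ring N) = range (residue_class N :: 'a :: field poly \<Rightarrow> _)"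
  unfolding cyclic_ring_def residue_class_def[abs_def] FactRing_def A_RCOSETS_def'
  by auto

lemma PIdl_residue_class:
  "PIdl\<^bsub>cyclic_ring N\<^esub> (residue_class N g) = (\<lambda>p. residue_class N (p * g)) ` UNIV"
  for g :: "'a :: field poly"
  using ring_hom_mult[OF residue_class_hom, of _ g N]
  unfolding cgenideal_def carrier_cyclic_ring by auto

section \<open>Words as polynomials, and generators of cyclic codes\<close>

abbreviation vec_poly :: "'a :: zero vec \<Rightarrow> 'a poly" where
  "vec_poly c \<equiv> Poly (list_of_vec c)"

declare coeff_Poly_eq [simp del]

lemma coeff_vec_poly [simp]: "coeff (vec_poly c) i = (if i < dim_vec c then c $ i else 0)"
  by (auto simp: coeff_Poly_eq nth_default_def list_of_vec_index)

lemma degree_vec_poly: "dim_vec c > 0 \<Longrightarrow> degree (vec_poly c) < dim_vec c"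
  by (rule degree_lessI) (auto simp: coeff_vec_poly)

lemma xpow_minus_one_neq_0: "N > 0 \<Longrightarrow> (xpow_minus_one N :: 'a :: field poly) \<noteq> 0"
  by (auto simp: poly_eq_iff dest!: spec[of _ N])

lemma degree_xpow_minus_one: "degree (xpow_minus_one N :: 'a :: field poly) = N"
proof (cases "N = 0")
  case False
  have "degree (monom 1 N + (- 1) :: 'a poly) = N"
    using False by (subst degree_add_eq_left) (auto simp: degree_monom_eq)
  then show ?thesis by simp
qed simp

text \<open>Divisibility by \<open>g\<close> is the same for all representatives modulo x^N - 1,
  because \<open>g\<close> divides x^N - 1. This moves the arguments from the quotient ring to
  divisibility of polynomials.\<close>

lemma mem_cyclic_code_of_iff:
  assumes "g dvd (xpow_minus_one N :: 'a :: field poly)"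
  shows "c \<in> cyclic_code_of N g \<longleftrightarrow> c \<in> carrier_vec N \<and> g dvd vec_poly c"
proof -
  have "(\<exists>p. xpow_minus_one N dvd vec_poly c - p * g) \<longleftrightarrow> g dvd vec_poly c"
  proof
    assume "\<exists>p. xpow_minus_one N dvd vec_poly c - p * g"
    then obtain p where "g dvd vec_poly c - p * g" using assms dvd_trans by blast
    then show "g dvd vec_poly c" using dvd_diffD1 by (metis dvd_add_right_iff dvd_triv_right diff_add_cancel add.commute)
  next
    assume "g dvd vec_poly c"
    then show "\<exists>p. xpow_minus_one N dvd vec_poly c - p * g"
      by (metis dvdE dvd_0_right mult.commute cancel_comm_monoid_add_class.diff_cancel)
  qed
  then show ?thesis
    by (auto simp: cyclic_code_of_def code_class_def PIdl_residue_class residue_class_eq_iff image_iff)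
qed

text \<open>Every residue class is hit by a word of length \<open>N\<close>, namely the coefficients
  of its remainder modulo x^N - 1.\<close>

lemma code_class_cyclic_code_of:
  assumes "N > 0"
  shows "code_class N ` cyclic_code_of N g = PIdl\<^bsub>cyclic_ring N\<^esub> (residue_class N (g :: 'a :: field poly))"
proof -
  have "\<exists>c \<in> carrier_vec N. code_class N c = residue_class N p" for p :: "'a poly"
  proof -
    let ?r = "p mod xpow_minus_one N" and ?c = "vec N (coeff (p mod xpow_minus_one N))"
    have "degree ?r < N"
      using degree_mod_less'[of "xpow_minus_one N :: 'a poly" p] assms
      by (cases "?r = 0") (use xpow_minus_one_neq_0[OF assms] in \<open>simp_all add: degree_xpow_minus_one del: right_minus_eq\<close>)
    then have "vec_poly ?c = ?r"
      unfolding poly_eq_iff coeff_vec_poly by (auto simp: coeff_eq_0)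
    then have "code_class N ?c = residue_class N p"
      by (simp add: code_class_def residue_class_eq_iff mod_eq_dvd_iff[symmetric])
    then show ?thesis by (intro bexI[of _ ?c]) auto
  qed
  then show ?thesis
    by (force simp: cyclic_code_of_def PIdl_residue_class image_iff)
qed

lemma is_generator_poly_cyclic_code_of:
  assumes "N > 0" "lead_coeff g = 1" "g dvd (xpow_minus_one N :: 'a :: field poly)"
  shows "is_generator_poly N (cyclic_code_of N g) g"
proof -
  have "residue_class N g \<in> carrier (cyclic_ring N)" by (simp add: carrier_cyclic_ring)
  then have "ideal (PIdl\<^bsub>cyclic_ring N\<^esub> (residue_class N g)) (cyclic_ring N)"
    by (rule cring.cgenideal_ideal[OF cring_cyclic_ring])
  moreover have "cyclic_code_of N g \<subseteq> carrier_vec N" by (auto simp: cyclic_code_of_def)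
  ultimately show ?thesis
    using assms by (simp add: is_generator_poly_def cyclic_code_def code_class_cyclic_code_of)
qed

lemma monic_dvd_antisym:
  assumes "p dvd q" "q dvd p" "lead_coeff p = 1" "lead_coeff q = (1 :: 'a :: field)"
  shows "p = q"
proof -
  obtain k where k: "q = p * k" using assms by blast
  have nz: "p \<noteq> 0" "q \<noteq> 0" using assms by auto
  then have "degree p = degree q"
    using assms by (intro antisym dvd_imp_degree_le) auto
  then have "degree k = 0" using k nz by (simp add: degree_mult_eq)
  moreover have "lead_coeff k = 1" using k assms by (simp add: lead_coeff_mult)
  ultimately have "k = 1" by (metis degree_eq_zeroE lead_coeff_pCons(2) one_pCons pCons_0_0)
  then show ?thesis using k by simp
qed

text \<open>Both candidates divide x^N - 1 and generate the same ideal, so each divides the other.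
  This is the uniqueness behind the \<open>THE\<close> in \<open>generator_poly\<close>.\<close>

lemma is_generator_poly_unique:
  assumes "is_generator_poly N C g" "is_generator_poly N C (g' :: 'a :: field poly)"
  shows "g = g'"
proof -
  have dvd: "a dvd b"
    if "is_generator_poly N C a" "is_generator_poly N C b" for a b :: "'a poly"
  proof -
    have "residue_class N b \<in> PIdl\<^bsub>cyclic_ring N\<^esub> (residue_class N a)"
      using that PIdl_residue_class[of N b] unfolding is_generator_poly_def
      by (metis (no_types, lifting) mult_1 rangeI)
    then obtain p where "xpow_minus_one N dvd b - p * a"
      by (auto simp: PIdl_residue_class residue_class_eq_iff)
    moreover have "a dvd xpow_minus_one N" using that by (simp add: is_generator_poly_def)
    ultimately have "a dvd b - p * a" by (rule dvd_trans[rotated])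
    then show ?thesis by (metis dvd_add_right_iff dvd_triv_right diff_add_cancel add.commute)
  qed
  show ?thesis
    using assms dvd[OF assms] dvd[OF assms(2) assms(1)]
    by (intro monic_dvd_antisym) (auto simp: is_generator_poly_def)
qed

lemma generator_poly_eqI: "is_generator_poly N C g \<Longrightarrow> generator_poly N C = g"
  unfolding generator_poly_def by (blast intro: is_generator_poly_unique)

lemma vec_poly_vec: "(\<And>i. i \<ge> N \<Longrightarrow> coeff p i = 0) \<Longrightarrow> vec_poly (vec N (coeff p)) = p"
  unfolding poly_eq_iff coeff_vec_poly by auto

lemma vec_poly_inj:
  assumes "c \<in> carrier_vec N" "d \<in> carrier_vec N" "vec_poly c = vec_poly d"
  shows "c = d"
proof (rule eq_vecI)
  fix i assume "i < dim_vec d"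
  then show "c $ i = d $ i"
    using assms coeff_vec_poly[of c i] coeff_vec_poly[of d i] by auto
qed (use assms in auto)

lemma vec_poly_add:
  "c \<in> carrier_vec N \<Longrightarrow> d \<in> carrier_vec N \<Longrightarrow> vec_poly (c + d) = vec_poly c + vec_poly (d :: 'a :: field vec)"
  unfolding poly_eq_iff coeff_add coeff_vec_poly by auto

lemma vec_poly_diff:
  "c \<in> carrier_vec N \<Longrightarrow> d \<in> carrier_vec N \<Longrightarrow> vec_poly (c - d) = vec_poly c - vec_poly (d :: 'a :: field vec)"
  unfolding poly_eq_iff coeff_diff coeff_vec_poly by auto

lemma vec_poly_smult:
  "vec_poly (a \<cdot>\<^sub>v c) = Polynomial.smult a (vec_poly (c :: 'a :: field vec))"
  unfolding poly_eq_iff coeff_smult coeff_vec_poly by auto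

lemma vec_poly_zero [simp]: "vec_poly (0\<^sub>v N) = (0 :: 'a :: field poly)"
  unfolding poly_eq_iff coeff_vec_poly by auto

section \<open>The dual and the dimension of a cyclic code\<close>

text \<open>For degree below \<open>N\<close> this is x^(N-1) p(1/x). \<open>reflect_poly\<close>
  reverses relative to the degree of \<open>p\<close>, but the scalar product needs reversal within
  a fixed window of \<open>N\<close> positions.\<close>

definition reversal :: "nat \<Rightarrow> 'a :: field poly \<Rightarrow> 'a poly" where
  "reversal N p = monom 1 (N - 1 - degree p) * reflect_poly p"

lemma coeff_reversal:
  assumes "p = 0 \<or> degree p < N"
  shows "coeff (reversal N p) i = (if i < N then coeff p (N - 1 - i) else 0)"
proof (cases "p = 0")
  case False
  with assms have deg: "degree p < N" by simp
  show ?thesis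
  proof (cases "i < N - 1 - degree p")
    case True
    then show ?thesis by (auto simp: reversal_def coeff_monom_mult coeff_eq_0)
  next
    case False
    then have "coeff (reversal N p) i = coeff (reflect_poly p) (i - (N - 1 - degree p))"
      by (simp add: reversal_def coeff_monom_mult)
    also have "\<dots> = (if i < N then coeff p (N - 1 - i) else 0)"
    proof -
      have "degree p < i - (N - 1 - degree p) \<longleftrightarrow> \<not> i < N" using deg False by auto
      moreover have "degree p - (i - (N - 1 - degree p)) = N - 1 - i" using deg False by auto
      ultimately show ?thesis by (simp add: coeff_reflect_poly)
    qed
    finally show ?thesis .
  qed
qed (simp add: reversal_def)

text \<open>Reflection drops all factors x, so reflecting twice removes exactly the power of x that
  divides \<open>p\<close>.\<close>

lemma reflect_reflect_dvd: "reflect_poly (reflect_poly p) dvd (p :: 'a :: field poly)"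
proof (cases "p = 0")
  case False
  then obtain r where r: "p = [:0, 1:] ^ order 0 p * r" "\<not> [:0, 1:] dvd r"
    using order_decomp[of p 0] by auto
  then have "coeff r 0 \<noteq> 0" by (simp add: poly_0_coeff_0[symmetric] poly_eq_0_iff_dvd)
  moreover have "reflect_poly p = reflect_poly r"
    by (subst r(1)) (simp add: reflect_poly_mult reflect_poly_power reflect_poly_pCons' pCons_one)
  ultimately have "reflect_poly (reflect_poly p) = r" by simp
  then show ?thesis using r(1) by (metis dvd_triv_right)
qed simp

text \<open>Reflection is multiplicative and ignores powers of x, and a second reflection restores
  \<open>H\<close> because its constant term is nonzero. This turns a condition on the reversed word
  into one on the word itself.\<close>

lemma dvd_reversal_iff:
  assumes "coeff H 0 \<noteq> 0"
  shows "H dvd reversal N p \<longleftrightarrow> reflect_poly H dvd p"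
proof
  assume "H dvd reversal N p"
  then have "reflect_poly H dvd reflect_poly (reversal N p)"
    by (auto simp: reflect_poly_mult elim!: dvdE)
  also have "reflect_poly (reversal N p) = reflect_poly (reflect_poly p)"
    by (simp add: reversal_def reflect_poly_mult monom_altdef reflect_poly_power reflect_poly_pCons' pCons_one)
  also note reflect_reflect_dvd
  finally show "reflect_poly H dvd p" .
next
  assume "reflect_poly H dvd p"
  then obtain K where "p = reflect_poly H * K" by (elim dvdE)
  then have "reflect_poly p = H * reflect_poly K" using assms by (simp add: reflect_poly_mult)
  then show "H dvd reversal N p" by (simp add: reversal_def)
qed

text \<open>Reversing one factor turns the scalar product into a single coefficient of a product of
  polynomials. If the factors are divisible by \<open>H\<close> and \<open>G\<close> with \<open>G H = x\<^sup>N - 1\<close>, that coefficient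
  vanishes for degree reasons.\<close>

lemma scalar_prod_eq_coeff:
  assumes "c \<in> carrier_vec N" "y \<in> carrier_vec N" "N > 0"
  shows "c \<bullet> y = coeff (reversal N (vec_poly c) * vec_poly y) (N - 1)"
proof -
  have deg: "degree (vec_poly c) < N" using degree_vec_poly[of c] assms by auto
  have "coeff (reversal N (vec_poly c) * vec_poly y) (N - 1)
    = (\<Sum>i\<le>N - 1. c $ (N - 1 - i) * y $ (N - 1 - i))"
    unfolding coeff_mult using assms deg by (intro sum.cong) (auto simp: coeff_reversal)
  also have "\<dots> = (\<Sum>i\<in>{0..<N}. c $ i * y $ i)"
    by (rule sum.reindex_bij_witness[of _ "\<lambda>i. N - 1 - i" "\<lambda>i. N - 1 - i"]) (use assms in auto)
  finally show ?thesis using assms by (simp add: scalar_prod_def)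
qed

text \<open>Orthogonality clears the coefficients of R G in degrees deg G to N - 1. Folding R G
  modulo x^N - 1 then leaves a multiple of G with no coefficient from degree deg G on, which must be
  0, so R G is a multiple of G H.\<close>

lemma cofactor_dvd_of_orthogonal_shifts:
  fixes G H R :: "'a :: field poly"
  assumes GH: "G * H = xpow_minus_one N" and N: "N > 0"
    and R: "\<And>i. i \<ge> N \<Longrightarrow> coeff R i = 0"
    and orth: "\<And>j. j < N - degree G \<Longrightarrow> coeff (R * (monom 1 j * G)) (N - 1) = 0"
  shows "H dvd R"
proof -
  have nz: "G \<noteq> 0" "H \<noteq> 0" using GH xpow_minus_one_neq_0[OF N] by auto
  have dG: "degree G \<le> N"
    using dvd_imp_degree_le[of G "xpow_minus_one N"] GH xpow_minus_one_neq_0[OF N]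
    by (metis degree_xpow_minus_one dvd_triv_left)
  define P where "P = R * G"
  have degP: "coeff P i = 0" if "i \<ge> N + degree G" for i
  proof -
    have "degree R \<le> N - 1" by (rule degree_le) (use N R in auto)
    then show ?thesis
      unfolding P_def using degree_mult_le[of R G] that N
      by (intro coeff_eq_0) auto
  qed
  have mid: "coeff P i = 0" if "degree G \<le> i" "i < N" for i
  proof -
    \<comment> \<open>The shift by j reads off coefficient N - 1 - j of \<open>P\<close>.\<close>
    have "coeff (R * (monom 1 (N - 1 - i) * G)) (N - 1) = coeff (monom 1 (N - 1 - i) * P) (N - 1)"
      by (simp add: P_def algebra_simps)
    also have "\<dots> = coeff P i" using that N by (simp add: coeff_monom_mult)
    finally show ?thesis using orth[of "N - 1 - i"] that by auto
  qed
  define P0 where "P0 = poly_cutoff N P"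
  define P1 where "P1 = poly_shift N P"
  have P: "P = P0 + monom 1 N * P1"
    unfolding poly_eq_iff P0_def P1_def
    by (auto simp: coeff_monom_mult coeff_poly_cutoff coeff_poly_shift)
  have "P = (P0 + P1) + xpow_minus_one N * P1" unfolding P by (simp add: algebra_simps)
  moreover have "G dvd P" "G dvd xpow_minus_one N * P1" by (auto simp: P_def GH[symmetric])
  ultimately have "G dvd P0 + P1" by (metis dvd_add_left_iff)
  moreover have "coeff (P0 + P1) i = 0" if "i \<ge> degree G" for i
    using that mid degP by (auto simp: P0_def P1_def coeff_poly_cutoff coeff_poly_shift)
  ultimately have "P0 + P1 = 0"
    using dvd_imp_degree_le[of G "P0 + P1"] leading_coeff_0_iff[of "P0 + P1"] by metis
  then have "P = xpow_minus_one N * P1" using P by (simp add: algebra_simps eq_neg_iff_add_eq_0)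
  then have "R * G = H * P1 * G" unfolding P_def GH[symmetric] by (simp add: algebra_simps)
  then have "R = H * P1" using nz by simp
  then show ?thesis by simp
qed

lemma reflect_xpow_minus_one: "N > 0 \<Longrightarrow> reflect_poly (xpow_minus_one N) = - (xpow_minus_one N :: 'a :: field poly)"
  unfolding poly_eq_iff coeff_reflect_poly degree_xpow_minus_one by auto

lemma coeff_0_cofactor:
  assumes "G * H = (xpow_minus_one N :: 'a :: field poly)" "N > 0"
  shows "coeff G 0 \<noteq> 0" "coeff H 0 \<noteq> 0"
proof -
  have "coeff G 0 * coeff H 0 = -1"
    using assms coeff_mult_0[of G H] by auto
  then show "coeff G 0 \<noteq> 0" "coeff H 0 \<noteq> 0" by auto
qed

lemma reflect_cofactor_dvd:
  assumes "G * H = (xpow_minus_one N :: 'a :: field poly)" "N > 0"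
  shows "reflect_poly H dvd xpow_minus_one N"
proof -
  have "reflect_poly G * reflect_poly H = - xpow_minus_one N"
    using assms by (metis reflect_poly_mult reflect_xpow_minus_one)
  then show ?thesis by (metis dvd_minus_iff dvd_triv_right)
qed

text \<open>Orthogonality to the shifts of \<open>G\<close> forces \<open>H\<close> to divide the
  reversed word, and a degree count gives the converse. The free scalar \<open>a\<close> serves both
  the normalisation by h(0) and the self-duality computation.\<close>

lemma dual_cyclic_code_of:
  fixes G H :: "'a :: field poly"
  assumes GH: "G * H = xpow_minus_one N" and N: "N > 0" and a: "a \<noteq> 0"
  shows "dual_code N (cyclic_code_of N G) = cyclic_code_of N (Polynomial.smult a (reflect_poly H))"
proof -
  have H0: "coeff H 0 \<noteq> 0" using coeff_0_cofactor[OF GH N] by simp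
  have dvd: "G dvd xpow_minus_one N" "Polynomial.smult a (reflect_poly H) dvd xpow_minus_one N"
    using GH a reflect_cofactor_dvd[OF GH N] by (auto simp: smult_dvd_iff intro: dvdI[OF GH[symmetric]])
  have dG: "degree G \<le> N" and nz: "G \<noteq> 0"
    using dvd_imp_degree_le[OF dvd(1) xpow_minus_one_neq_0[OF N]] GH xpow_minus_one_neq_0[OF N]
    by (auto simp: degree_xpow_minus_one)
  have key: "(\<forall>y \<in> cyclic_code_of N G. c \<bullet> y = 0) \<longleftrightarrow> reflect_poly H dvd vec_poly c"
    if c: "c \<in> carrier_vec N" for c
  proof -
    define R where "R = reversal N (vec_poly c)"
    have degc: "degree (vec_poly c) < N" using degree_vec_poly[of c] c N by auto
    have "(\<forall>y \<in> cyclic_code_of N G. c \<bullet> y = 0) \<longleftrightarrow> H dvd R"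
    proof
      assume *: "\<forall>y \<in> cyclic_code_of N G. c \<bullet> y = 0"
      show "H dvd R"
      proof (rule cofactor_dvd_of_orthogonal_shifts[OF GH N])
        show "coeff R i = 0" if "i \<ge> N" for i
          using that degc by (simp add: R_def coeff_reversal)
        fix j assume j: "j < N - degree G"
        have vp: "vec_poly (vec N (coeff (monom 1 j * G))) = monom 1 j * G"
          using j by (intro vec_poly_vec) (auto simp: coeff_monom_mult coeff_eq_0)
        moreover have "vec N (coeff (monom 1 j * G)) \<in> cyclic_code_of N G"
          by (simp only: mem_cyclic_code_of_iff[OF dvd(1)] vp) simp
        ultimately show "coeff (R * (monom 1 j * G)) (N - 1) = 0"
          using * scalar_prod_eq_coeff[OF c _ N] by (metis R_def vec_carrier)
      qed
    next
      assume "H dvd R"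
      then obtain K where K: "R = H * K" by (elim dvdE)
      show "\<forall>y \<in> cyclic_code_of N G. c \<bullet> y = 0"
      proof
        fix y assume y: "y \<in> cyclic_code_of N G"
        then have yc: "y \<in> carrier_vec N" and "G dvd vec_poly y"
          by (auto simp: mem_cyclic_code_of_iff[OF dvd(1)])
        then obtain L where L: "vec_poly y = G * L" by (elim dvdE)
        define M where "M = K * L"
        have "R * vec_poly y = (G * H) * M" by (simp add: K L M_def mult_ac)
        then have prod: "R * vec_poly y = monom 1 N * M - M" by (simp add: GH left_diff_distrib)
        \<comment> \<open>Two factors of degree at most N - 1 have product (x^N - 1) M, so a nonzero
          \<open>M\<close> has degree at most N - 2.\<close>
        have "coeff M (N - 1) = 0"
        proof (cases "M = 0")
          case False
          have "degree R \<le> N - 1" by (rule degree_le) (use degc N in \<open>auto simp: R_def coeff_reversal\<close>)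
          moreover have "degree (vec_poly y) \<le> N - 1" using degree_vec_poly[of y] yc N by auto
          ultimately have "degree (R * vec_poly y) \<le> N - 1 + (N - 1)"
            using degree_mult_le[of R "vec_poly y"] by linarith
          moreover have "R * vec_poly y = xpow_minus_one N * M" by (simp add: prod algebra_simps)
          then have "degree (R * vec_poly y) = N + degree M"
            using degree_mult_eq[OF xpow_minus_one_neq_0[OF N] False] by (simp add: degree_xpow_minus_one)
          ultimately have "degree M < N - 1" using N by auto
          then show ?thesis by (simp add: coeff_eq_0)
        qed simp
        then show "c \<bullet> y = 0"
          using scalar_prod_eq_coeff[OF c yc N] prod N by (simp add: R_def[symmetric] coeff_monom_mult)
      qed
    qed
    then show ?thesis by (simp add: R_def dvd_reversal_iff[OF H0])
  qed
  have "c \<in> dual_code N (cyclic_code_of N G) \<longleftrightarrow>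
      c \<in> carrier_vec N \<and> Polynomial.smult a (reflect_poly H) dvd vec_poly c" for c
    unfolding dual_code_def mem_Collect_eq
    by (cases "c \<in> carrier_vec N") (simp_all add: key smult_dvd_iff a)
  then show ?thesis using mem_cyclic_code_of_iff[OF dvd(2)] by blast
qed

section \<open>Cyclic codes as subspaces and their dimension\<close>

lemma subspace_cyclic_code_of:
  assumes "g dvd (xpow_minus_one N :: 'a :: field poly)"
  shows "VectorSpace.subspace (class_ring :: 'a ring) (cyclic_code_of N g) (module_vec TYPE('a) N)"
proof -
  interpret vec_space "TYPE('a)" N .
  show ?thesis
    unfolding VectorSpace.subspace_def submodule_def
    using assms vectorspace_axioms module_axioms
    by (auto simp: mem_cyclic_code_of_iff module_vec_simps vec_poly_add[of _ N] vec_poly_smult 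
        class_ring_simps intro: dvd_smult)
qed

text \<open>Multiplication by \<open>g\<close> maps the words of length N - deg g linearly and
  injectively onto the code, so rank-nullity gives the dimension.\<close>

lemma dim_cyclic_code_of:
  fixes g :: "'a :: field poly"
  assumes g: "g dvd xpow_minus_one N" and N: "N > 0"
  shows "vectorspace.dim (class_ring :: 'a ring) ((module_vec TYPE('a) N)\<lparr>carrier := cyclic_code_of N g\<rparr>)
    = N - degree g"
proof -
  define k where "k = N - degree g"
  define T where "T v = vec N (coeff (g * vec_poly v))" for v :: "'a vec"
  have nz: "g \<noteq> 0" using g xpow_minus_one_neq_0[OF N] by auto
  have dg: "degree g \<le> N"
    using dvd_imp_degree_le[OF g xpow_minus_one_neq_0[OF N]] by (simp add: degree_xpow_minus_one)
  have vT: "vec_poly (T v) = g * vec_poly v" if "v \<in> carrier_vec k" for v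
    unfolding T_def
  proof (rule vec_poly_vec)
    fix i assume i: "i \<ge> N"
    show "coeff (g * vec_poly v) i = 0"
    \<comment> \<open>For k = 0 the zero polynomial has degree 0, which is not below
      \<open>k\<close>, so the degree bound of the other case fails.\<close>
    proof (cases "k = 0")
      case True
      then have "vec_poly v = 0" using that unfolding poly_eq_iff coeff_vec_poly by auto
      then show ?thesis by simp
    next
      case False
      then have "degree (vec_poly v) < k" using degree_vec_poly[of v] that by auto
      then have "degree (g * vec_poly v) < i"
        using degree_mult_le[of g "vec_poly v"] i dg by (auto simp: k_def)
      then show ?thesis by (rule coeff_eq_0)
    qed
  qed
  interpret V: vec_space "TYPE('a)" k .
  interpret W: vec_space "TYPE('a)" N .
  have "T \<in> LinearCombinations.module_hom (class_ring :: 'a ring) (module_vec TYPE('a) k) (module_vec TYPE('a) N)"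
    unfolding LinearCombinations.module_hom_def
    by (auto simp: module_vec_simps class_ring_simps vec_poly_add[of _ k] vec_poly_smult T_def algebra_simps
        intro!: eq_vecI)
  then interpret T: linear_map "class_ring :: 'a ring" "module_vec TYPE('a) k" "module_vec TYPE('a) N" T
    by unfold_locales
  have ker: "T.kerT = {0\<^sub>v k}"
  proof (intro equalityI subsetI)
    fix v :: "'a vec" assume "v \<in> T.kerT"
    then have v: "v \<in> carrier_vec k" "T v = 0\<^sub>v N" by (auto simp: T.ker_def module_vec_simps)
    then have "vec_poly v = 0" using vT[of v] nz by simp
    then have "vec_poly v = vec_poly (0\<^sub>v k)" by simp
    then show "v \<in> {0\<^sub>v k}" using v vec_poly_inj[of v k "0\<^sub>v k"] by simp
  next
    fix v :: "'a vec" assume "v \<in> {0\<^sub>v k}"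
    then have "v \<in> carrier_vec k" "T v = 0\<^sub>v N" by (auto simp: T_def intro!: eq_vecI)
    then show "v \<in> T.kerT" by (auto simp: T.ker_def module_vec_simps)
  qed
  have im: "T.imT = cyclic_code_of N g"
  proof (intro equalityI subsetI)
    fix c assume "c \<in> T.imT"
    then obtain v where "v \<in> carrier_vec k" "c = T v" by (auto simp: T.im_def module_vec_simps)
    then show "c \<in> cyclic_code_of N g"
      using vT[of v] by (simp only: mem_cyclic_code_of_iff[OF g]) (simp add: T_def)
  next
    fix c assume "c \<in> cyclic_code_of N g"
    then have c: "c \<in> carrier_vec N" "g dvd vec_poly c" by (auto simp: mem_cyclic_code_of_iff[OF g])
    then obtain r where r: "vec_poly c = g * r" by (elim dvdE)
    have "coeff r i = 0" if "i \<ge> k" for i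
    proof (cases "r = 0")
      case False
      have "degree (g * r) < N" using r degree_vec_poly[of c] c N by auto
      then have "degree r < i" using degree_mult_eq[OF nz False] that by (auto simp: k_def)
      then show ?thesis by (rule coeff_eq_0)
    qed simp
    then have v: "vec_poly (vec k (coeff r)) = r" by (rule vec_poly_vec)
    have "T (vec k (coeff r)) = c"
      using vT[of "vec k (coeff r)"] v r c by (intro vec_poly_inj[of _ N]) (auto simp: T_def)
    then show "c \<in> T.imT" unfolding T.im_def module_vec_simps by (metis imageI vec_carrier)
  qed
  have "vectorspace.dim (class_ring :: 'a ring) ((module_vec TYPE('a) k)\<lparr>carrier := T.kerT\<rparr>) = card ({} :: 'a vec set)"
  proof (rule vectorspace.dim_basis)
    show vs: "vectorspace (class_ring :: 'a ring) ((module_vec TYPE('a) k)\<lparr>carrier := T.kerT\<rparr>)"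
      by (rule V.subspace_is_vs[OF T.kerT_is_subspace])
    interpret K: vectorspace "class_ring :: 'a ring" "(module_vec TYPE('a) k)\<lparr>carrier := T.kerT\<rparr>" by (rule vs)
    have "K.lin_indpt {}" unfolding K.lin_dep_def by simp
    moreover have "K.span {} = T.kerT" using K.span_empty by (simp add: ker module_vec_simps)
    ultimately show "K.basis {}" unfolding K.basis_def by simp
  qed simp
  then have "vectorspace.dim (class_ring :: 'a ring) ((module_vec TYPE('a) N)\<lparr>carrier := cyclic_code_of N g\<rparr>) = k"
    using T.rank_nullity[OF V.fin_dim] im by (simp add: V.dim_is_n)
  then show ?thesis by (simp only: k_def)
qed

section \<open>Minimum distance and the repeated-root code of double length\<close>

definition weight :: "'a :: zero vec \<Rightarrow> nat" where
  "weight c = card {i. i < dim_vec c \<and> c $ i \<noteq> 0}"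

lemma hamming_dist_eq_weight:
  "u \<in> carrier_vec N \<Longrightarrow> v \<in> carrier_vec N \<Longrightarrow> hamming_dist u v = weight (u - v)"
  for u :: "'a :: field vec"
  unfolding hamming_dist_def weight_def by (rule arg_cong[of _ _ card]) auto

lemma min_dist_le_weight:
  fixes C :: "'a :: field vec set"
  assumes "C \<subseteq> carrier_vec N" "0\<^sub>v N \<in> C" "c \<in> C" "c \<noteq> 0\<^sub>v N"
  shows "min_dist C \<le> weight c"
proof -
  have "hamming_dist c (0\<^sub>v N) = weight c"
    using assms hamming_dist_eq_weight[of c N "0\<^sub>v N"] by (metis subsetD minus_zero_vec)
  then have "weight c \<in> {hamming_dist u v | u v. u \<in> C \<and> v \<in> C \<and> u \<noteq> v}" using assms by force
  then show ?thesis unfolding min_dist_def by (intro cInf_lower) auto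
qed

text \<open>Closure under differences turns distances into weights, and a nonempty set of naturals
  attains its infimum. The nonzero word \<open>w\<close> rules out the default value of
  \<open>Inf\<close> on the empty set.\<close>

lemma min_dist_attained:
  fixes C :: "'a :: field vec set"
  assumes C: "C \<subseteq> carrier_vec N" and diff: "\<And>u v. u \<in> C \<Longrightarrow> v \<in> C \<Longrightarrow> u - v \<in> C"
    and nontriv: "0\<^sub>v N \<in> C" "w \<in> C" "w \<noteq> 0\<^sub>v N"
  obtains c where "c \<in> C" "c \<noteq> 0\<^sub>v N" "weight c = min_dist C"
proof -
  have "{hamming_dist u v | u v. u \<in> C \<and> v \<in> C \<and> u \<noteq> v} \<noteq> {}" using nontriv by blast
  from Inf_nat_def1[OF this] obtain u v where uv: "u \<in> C" "v \<in> C" "u \<noteq> v"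
    and *: "min_dist C = hamming_dist u v"
    unfolding min_dist_def by blast
  have carr: "u \<in> carrier_vec N" "v \<in> carrier_vec N" using uv C by auto
  have "u - v \<noteq> 0\<^sub>v N"
  proof
    assume "u - v = 0\<^sub>v N"
    have "u = v"
    proof (rule eq_vecI)
      fix i assume i: "i < dim_vec v"
      have "(u - v) $ i = 0" using \<open>u - v = 0\<^sub>v N\<close> i carr by simp
      then show "u $ i = v $ i" using i carr by simp
    qed (use carr in simp)
    then show False using uv by simp
  qed
  then show ?thesis
    using that[OF diff[OF uv(1,2)]] hamming_dist_eq_weight[OF carr] * by simp
qed

lemma cyclic_code_of_zero: "g dvd xpow_minus_one N \<Longrightarrow> 0\<^sub>v N \<in> cyclic_code_of N (g :: 'a :: field poly)"
  by (simp add: mem_cyclic_code_of_iff)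

lemma cyclic_code_of_diff:
  "g dvd xpow_minus_one N \<Longrightarrow> u \<in> cyclic_code_of N g \<Longrightarrow> v \<in> cyclic_code_of N g
    \<Longrightarrow> u - v \<in> cyclic_code_of N (g :: 'a :: field poly)"
  by (auto simp: mem_cyclic_code_of_iff vec_poly_diff[of _ N])

lemma cyclic_code_of_carrier: "cyclic_code_of N g \<subseteq> carrier_vec N"
  by (auto simp: cyclic_code_of_def)

lemma cyclic_code_of_nontrivial:
  assumes "g dvd (xpow_minus_one N :: 'a :: field poly)" "degree g < N"
  obtains c where "c \<in> cyclic_code_of N g" "c \<noteq> 0\<^sub>v N"
proof
  have g: "g \<noteq> 0" using assms xpow_minus_one_neq_0[of N, where ?'a = 'a] by auto
  have vp: "vec_poly (vec N (coeff g)) = g"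
    using assms by (intro vec_poly_vec) (auto simp: coeff_eq_0)
  then show "vec N (coeff g) \<in> cyclic_code_of N g"
    by (simp only: mem_cyclic_code_of_iff[OF assms(1)]) simp
  show "vec N (coeff g) \<noteq> 0\<^sub>v N" using g vp by (metis vec_poly_zero)
qed

text \<open>Since \<open>n\<close> is odd, a position in \<open>{0..<2n}\<close> is determined by its residue modulo \<open>n\<close> and its
  parity. In characteristic two the word of the odd positions is \<open>x c'(x)\<close>, so regrouping the positions
  exhibits the code of length \<open>2n\<close> as a \<open>(u | u + v)\<close> construction.\<close>

definition even_part :: "nat \<Rightarrow> 'a vec \<Rightarrow> 'a vec" where
  "even_part n c = vec n (\<lambda>i. if even i then c $ i else c $ (i + n))"

definition odd_part :: "nat \<Rightarrow> 'a vec \<Rightarrow> 'a vec" where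
  "odd_part n c = vec n (\<lambda>i. if even i then c $ (i + n) else c $ i)"

definition interleave :: "nat \<Rightarrow> 'a vec \<Rightarrow> 'a vec \<Rightarrow> 'a vec" where
  "interleave n u v = vec (2 * n) (\<lambda>j. if even j then u $ (j mod n) else v $ (j mod n))"

lemma parts_carrier [simp]:
  "even_part n c \<in> carrier_vec n" "odd_part n c \<in> carrier_vec n" "interleave n u v \<in> carrier_vec (2 * n)"
  by (auto simp: even_part_def odd_part_def interleave_def)

lemma parts_interleave:
  assumes "odd n" "u \<in> carrier_vec n" "v \<in> carrier_vec n"
  shows "even_part n (interleave n u v) = u" "odd_part n (interleave n u v) = v"
  using assms by (auto simp: even_part_def odd_part_def interleave_def intro!: eq_vecI)

lemma weight_parts:
  assumes n: "odd n" and c: "c \<in> carrier_vec (2 * n)"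
  shows "weight c = weight (even_part n c) + weight (odd_part n (c :: 'a :: zero vec))"
proof -
  let ?S = "{j. j < 2 * n \<and> c $ j \<noteq> 0}"
  have npos: "n > 0" using n by (cases n) auto
  have mod: "j mod n = (if j < n then j else j - n)" if "j < 2 * n" for j
    using that by (simp add: mod_if le_mod_geq)
  \<comment> \<open>Since \<open>n\<close> is odd, exactly one of \<open>i\<close> and
    \<open>i + n\<close> is even; choosing it gives the inverse map.\<close>
  have "bij_betw (\<lambda>j. j mod n) {j \<in> ?S. even j} {i. i < n \<and> even_part n c $ i \<noteq> 0}"
    by (rule bij_betw_byWitness[where f' = "\<lambda>i. if even i then i else i + n"])
       (use n in \<open>auto simp: mod even_part_def\<close>)
  moreover have "bij_betw (\<lambda>j. j mod n) {j \<in> ?S. odd j} {i. i < n \<and> odd_part n c $ i \<noteq> 0}"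
    by (rule bij_betw_byWitness[where f' = "\<lambda>i. if odd i then i else i + n"])
       (use n in \<open>auto simp: mod odd_part_def\<close>)
  moreover have "card ?S = card {j \<in> ?S. even j} + card {j \<in> ?S. odd j}"
    by (subst card_Un_disjoint[symmetric]) (auto intro: arg_cong[of _ _ card])
  ultimately show ?thesis
    using c by (simp add: weight_def bij_betw_same_card even_part_def odd_part_def cong: conj_cong)
qed

section \<open>The code of length 2n as a (u | u + v) construction\<close>

lemma fold_dvd:
  "xpow_minus_one n dvd q - (poly_cutoff n q + poly_shift n q)" for q :: "'a :: field poly"
proof -
  have "q = poly_cutoff n q + monom 1 n * poly_shift n q"
    unfolding poly_eq_iff by (auto simp: coeff_monom_mult coeff_poly_cutoff coeff_poly_shift)
  then have "q - (poly_cutoff n q + poly_shift n q) = xpow_minus_one n * poly_shift n q"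
    by (simp add: algebra_simps) 
  then show ?thesis by simp
qed

lemma dvd_iff_of_dvd_diff:
  fixes d :: "'a :: comm_ring_1"
  assumes "d dvd m" "m dvd a - b"
  shows "d dvd a \<longleftrightarrow> d dvd b"
  using dvd_trans[OF assms] by (metis dvd_add_right_iff diff_add_cancel)

lemma of_nat_char_two:
  assumes "(1 :: 'a :: ring_1) + 1 = 0"
  shows "(of_nat k :: 'a) = (if even k then 0 else 1)"
  by (induction k) (use assms in \<open>auto simp: add.commute\<close>)

text \<open>Since \<open>n\<close> is odd, x^n - 1 is separable, so d' is invertible modulo
  \<open>d\<close>. Writing p = d K gives p' = d' K modulo \<open>g\<close>, so \<open>g\<close>
  divides p' exactly when it divides K. The factor x is there because x p'(x) keeps exactly the
  terms of odd degree in characteristic two.\<close>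

lemma mult_dvd_iff_pderiv:
  fixes g d p :: "'a :: field poly"
  assumes char: "(1 :: 'a) + 1 = 0" and n: "odd n"
    and g: "g dvd d" and d: "d dvd xpow_minus_one n"
  shows "g * d dvd p \<longleftrightarrow> d dvd p \<and> g dvd monom 1 1 * pderiv p"
proof
  assume gd: "g * d dvd p"
  obtain f where f: "d = g * f" using g by (elim dvdE)
  obtain K where "p = g * d * K" using gd by (elim dvdE)
  then have "p = g * (g * f * K)" by (simp add: f mult_ac)
  then have "g dvd pderiv p" by (simp add: pderiv_mult algebra_simps)
  then show "d dvd p \<and> g dvd monom 1 1 * pderiv p"
    using gd by (auto intro: dvd_trans)
next
  assume *: "d dvd p \<and> g dvd monom 1 1 * pderiv p"
  obtain k where k: "xpow_minus_one n = d * k" using d by (elim dvdE)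
  \<comment> \<open>Multiplying by x^(n-1) and replacing x^n by 1 cancels the factor x modulo
    \<open>g\<close>.\<close>
  have "g dvd monom 1 1 * pderiv p * monom 1 (n - 1) - xpow_minus_one n * pderiv p"
    using * k g by (intro dvd_diff) (auto intro: dvd_mult2)
  also have "monom 1 1 * pderiv p * monom 1 (n - 1) = monom 1 n * pderiv p"
  proof -
    have "monom 1 1 * monom 1 (n - 1) = (monom 1 n :: 'a poly)"
      using n by (simp add: mult_monom odd_pos)
    then show ?thesis by (metis mult.commute mult.left_commute)
  qed
  finally have gp: "g dvd pderiv p" by (simp add: algebra_simps)
  obtain K where K: "p = d * K" using * by (elim conjE dvdE)
  have "g dvd pderiv d * K"
  proof -
    have "pderiv d * K = pderiv p - d * pderiv K" by (simp add: K pderiv_mult algebra_simps)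
    then show ?thesis using gp g by (auto intro: dvd_mult2)
  qed
  \<comment> \<open>As n = 1 in the field, x (x^n - 1)' - (x^n - 1) = 1; this Bezout identity
    inverts d' modulo \<open>d\<close>.\<close>
  have "monom 1 n = monom 1 1 * pderiv (xpow_minus_one n :: 'a poly)"
    using n of_nat_char_two[OF char, of n] by (simp add: pderiv_diff pderiv_monom mult_monom odd_pos)
  also have "\<dots> = monom 1 1 * (d * pderiv k + k * pderiv d)" by (simp add: k pderiv_mult)
  finally have "1 = monom 1 1 * (d * pderiv k + k * pderiv d) - xpow_minus_one n" by simp
  then have "K = (monom 1 1 * (d * pderiv k + k * pderiv d) - d * k) * K" by (simp add: k)
  also have "\<dots> = d * ((monom 1 1 * pderiv k - k) * K) + (pderiv d * K) * (monom 1 1 * k)"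
    by (simp add: algebra_simps)
  also have "g dvd \<dots>" using g \<open>g dvd pderiv d * K\<close> by (intro dvd_add) (auto intro: dvd_mult2)
  finally show "g * d dvd p" unfolding K by (simp add: mult.commute mult_dvd_mono)
qed

text \<open>Folding \<open>c\<close> modulo x^n - 1 gives the sum of its two parts, and folding x
  p'(x) gives the odd part alone.\<close>

lemma doubled_code_iff:
  fixes g d :: "'a :: field poly"
  assumes char: "(1 :: 'a) + 1 = 0" and n: "odd n"
    and g: "g dvd d" and d: "d dvd xpow_minus_one n" and c: "c \<in> carrier_vec (2 * n)"
  shows "g * d dvd vec_poly c \<longleftrightarrow>
    odd_part n c \<in> cyclic_code_of n g \<and> even_part n c + odd_part n c \<in> cyclic_code_of n d"
proof -
  let ?p = "vec_poly c"
  have g': "g dvd xpow_minus_one n" using g d by (rule dvd_trans)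
  have "poly_cutoff n ?p + poly_shift n ?p = vec_poly (even_part n c + odd_part n c)"
    unfolding poly_eq_iff coeff_add coeff_poly_cutoff coeff_poly_shift coeff_vec_poly
    using c by (auto simp: even_part_def odd_part_def)
  then have 1: "d dvd ?p \<longleftrightarrow> d dvd vec_poly (even_part n c + odd_part n c)"
    using dvd_iff_of_dvd_diff[OF d fold_dvd[of n ?p]] by simp
  have co: "coeff (monom 1 1 * pderiv ?p) i = (if odd i then coeff ?p i else 0)" for i
    using of_nat_char_two[OF char, of i]
    by (cases i) (auto simp: coeff_monom_mult coeff_pderiv simp del: of_nat_Suc)
  have "poly_cutoff n (monom 1 1 * pderiv ?p) + poly_shift n (monom 1 1 * pderiv ?p) = vec_poly (odd_part n c)"
    unfolding poly_eq_iff coeff_add coeff_poly_cutoff coeff_poly_shift co coeff_vec_poly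
    using c n by (auto simp: odd_part_def)
  then have 2: "g dvd monom 1 1 * pderiv ?p \<longleftrightarrow> g dvd vec_poly (odd_part n c)"
    using dvd_iff_of_dvd_diff[OF g' fold_dvd[of n "monom 1 1 * pderiv ?p"]] by simp
  show ?thesis
    unfolding mult_dvd_iff_pderiv[OF char n g d] 1 2 mem_cyclic_code_of_iff[OF g'] mem_cyclic_code_of_iff[OF d]
    by auto
qed

text \<open>If the two parts of a codeword sum to 0, their weights agree and the odd part is a
  nonzero word of the larger code. Otherwise the sum is a nonzero word of the smaller code, of
  weight at most that of the whole.\<close>

lemma min_dist_doubled_code:
  fixes g d :: "'a :: field poly"
  assumes char: "(1 :: 'a) + 1 = 0" and n: "odd n"
    and g: "g dvd d" and d: "d dvd xpow_minus_one n" and deg: "degree d < n"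
    and gd: "g * d dvd xpow_minus_one (2 * n)"
  shows "min_dist (cyclic_code_of (2 * n) (g * d))
    = min (2 * min_dist (cyclic_code_of n g)) (min_dist (cyclic_code_of n d))"
proof (rule antisym)
  let ?C = "cyclic_code_of n g" and ?D = "cyclic_code_of n d" and ?E = "cyclic_code_of (2 * n) (g * d)"
  have npos: "n > 0" using n by (cases n) auto
  have g': "g dvd xpow_minus_one n" using g d by (rule dvd_trans)
  have dnz: "d \<noteq> 0" using d xpow_minus_one_neq_0[OF npos] by auto
  have degg: "degree g < n" using dvd_imp_degree_le[OF g dnz] deg by simp
  have E_iff: "c \<in> ?E \<longleftrightarrow> c \<in> carrier_vec (2 * n) \<and> odd_part n c \<in> ?C \<and> even_part n c + odd_part n c \<in> ?D" for c
    unfolding mem_cyclic_code_of_iff[OF gd] using doubled_code_iff[OF char n g d, of c] by auto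
  have interleaveE: "interleave n u v \<in> ?E" "weight (interleave n u v) = weight u + weight v"
    if "u \<in> carrier_vec n" "v \<in> ?C" "u + v \<in> ?D" for u v
  proof -
    have v: "v \<in> carrier_vec n" using that cyclic_code_of_carrier by auto
    show "interleave n u v \<in> ?E"
      using that v by (simp add: E_iff parts_interleave[OF n])
    show "weight (interleave n u v) = weight u + weight v"
      using that v by (subst weight_parts[OF n]) (simp_all add: parts_interleave[OF n])
  qed
  have pos: "c \<noteq> 0\<^sub>v N \<longleftrightarrow> weight c > 0" if "c \<in> carrier_vec N" for c :: "'a vec" and N
    using that by (auto simp: weight_def card_gt_0_iff intro!: eq_vecI)
  have E0: "?E \<subseteq> carrier_vec (2 * n)" "0\<^sub>v (2 * n) \<in> ?E"
    using cyclic_code_of_carrier cyclic_code_of_zero[OF gd] by auto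
  obtain u where u: "u \<in> ?C" "u \<noteq> 0\<^sub>v n" "weight u = min_dist ?C"
    using cyclic_code_of_nontrivial[OF g' degg] min_dist_attained[OF cyclic_code_of_carrier cyclic_code_of_diff[OF g'] cyclic_code_of_zero[OF g']]
    by metis
  obtain v where v: "v \<in> ?D" "v \<noteq> 0\<^sub>v n" "weight v = min_dist ?D"
    using cyclic_code_of_nontrivial[OF d deg] min_dist_attained[OF cyclic_code_of_carrier cyclic_code_of_diff[OF d] cyclic_code_of_zero[OF d]]
    by metis
  have uc: "u \<in> carrier_vec n" and vc: "v \<in> carrier_vec n" using u v cyclic_code_of_carrier by auto
  have wu: "weight (- u) = weight u" using uc by (auto simp: weight_def intro!: arg_cong[of _ _ card])
  \<comment> \<open>The parts sum to 0, a word of \<open>?D\<close>, so this codeword attains twice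
    the minimum distance of \<open>?C\<close>.\<close>
  have "interleave n (- u) u \<in> ?E" "weight (interleave n (- u) u) = 2 * weight u"
    using interleaveE[of "- u" u] u uc wu cyclic_code_of_zero[OF d] by (auto simp: uminus_l_inv_vec)
  moreover have "weight u > 0" using pos[OF uc] u by simp
  ultimately have 1: "min_dist ?E \<le> 2 * min_dist ?C"
    using min_dist_le_weight[OF E0, of "interleave n (- u) u"] pos[of "interleave n (- u) u" "2 * n"] u by auto
  have w0: "weight (0\<^sub>v n :: 'a vec) = 0" by (simp add: weight_def)
  \<comment> \<open>The odd part is 0 and the sum is \<open>v\<close>, so this codeword attains the
    minimum distance of \<open>?D\<close>.\<close>
  have "interleave n v (0\<^sub>v n) \<in> ?E" "weight (interleave n v (0\<^sub>v n)) = weight v"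
    using interleaveE[of v "0\<^sub>v n"] v vc w0 cyclic_code_of_zero[OF g'] by auto
  moreover have "weight v > 0" using pos[OF vc] v by simp
  ultimately have 2: "min_dist ?E \<le> min_dist ?D"
    using min_dist_le_weight[OF E0, of "interleave n v (0\<^sub>v n)"] pos[of "interleave n v (0\<^sub>v n)" "2 * n"] v by auto
  show "min_dist ?E \<le> min (2 * min_dist ?C) (min_dist ?D)" using 1 2 by simp
  have "interleave n v (0\<^sub>v n) \<noteq> 0\<^sub>v (2 * n)"
    using pos[of "interleave n v (0\<^sub>v n)" "2 * n"] \<open>weight v > 0\<close> \<open>weight (interleave n v (0\<^sub>v n)) = weight v\<close> by simp
  then obtain c where c: "c \<in> ?E" "c \<noteq> 0\<^sub>v (2 * n)" "weight c = min_dist ?E"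
    using min_dist_attained[OF E0(1) cyclic_code_of_diff[OF gd] E0(2)] \<open>interleave n v (0\<^sub>v n) \<in> ?E\<close> by metis
  let ?e = "even_part n c" and ?o = "odd_part n c"
  have cc: "c \<in> carrier_vec (2 * n)" "?o \<in> ?C" "?e + ?o \<in> ?D" using c(1) E_iff by auto
  have wc: "weight c = weight ?e + weight ?o" by (rule weight_parts[OF n cc(1)])
  have dims: "dim_vec ?e = n" "dim_vec ?o = n" by (simp_all add: even_part_def odd_part_def)
  show "min (2 * min_dist ?C) (min_dist ?D) \<le> min_dist ?E"
  proof (cases "?e + ?o = 0\<^sub>v n")
    case True
    have "?e $ i = 0 \<longleftrightarrow> ?o $ i = 0" if "i < n" for i
    proof -
      have "?e $ i + ?o $ i = 0" using arg_cong[OF True, of "\<lambda>w. w $ i"] that dims by simp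
      then show ?thesis by (metis add.right_neutral add.left_neutral)
    qed
    then have "{i. i < n \<and> ?e $ i \<noteq> 0} = {i. i < n \<and> ?o $ i \<noteq> 0}" by auto
    then have "weight ?e = weight ?o" by (simp add: weight_def dims)
    moreover have "weight c > 0" using pos[OF cc(1)] c(2) by simp
    ultimately have "?o \<noteq> 0\<^sub>v n" using wc pos[of ?o n] by simp
    then have "min_dist ?C \<le> weight ?o"
      by (intro min_dist_le_weight[OF cyclic_code_of_carrier cyclic_code_of_zero[OF g'] cc(2)])
    then show ?thesis using wc \<open>weight ?e = weight ?o\<close> c(3) by simp
  next
    case False
    then have "min_dist ?D \<le> weight (?e + ?o)"
      by (intro min_dist_le_weight[OF cyclic_code_of_carrier cyclic_code_of_zero[OF d] cc(3)])
    also have "\<dots> \<le> card ({i. i < n \<and> ?e $ i \<noteq> 0} \<union> {i. i < n \<and> ?o $ i \<noteq> 0})"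
      unfolding weight_def by (intro card_mono) (auto simp: dims)
    also have "\<dots> \<le> weight ?e + weight ?o" unfolding weight_def dims by (rule card_Un_le)
    finally show ?thesis using wc c(3) by simp
  qed
qed

text \<open>In characteristic two x^(2n) - 1 = (x^n - 1)^2. With r(p) for the reflection of p, the
  cofactor of g r(h) is therefore h r(g) up to a scalar, and reflecting it returns g r(h).\<close>

lemma self_dual_doubled_code:
  fixes g h :: "'a :: field poly"
  assumes char: "(1 :: 'a) + 1 = 0" and n: "n > 0" and gh: "g * h = xpow_minus_one n"
    and gp: "gp = Polynomial.smult (inverse (poly h 0)) (reflect_poly h)"
  shows "g * gp dvd xpow_minus_one (2 * n)" "self_dual (2 * n) (cyclic_code_of (2 * n) (g * gp))"
proof -
  have g0: "coeff g 0 \<noteq> 0" and h0: "coeff h 0 \<noteq> 0" using coeff_0_cofactor[OF gh n] by auto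
  have ph: "poly h 0 = coeff h 0" by (simp add: poly_0_coeff_0)
  define H where "H = Polynomial.smult (- coeff h 0) (h * reflect_poly g)"
  have refl: "reflect_poly g * reflect_poly h = - xpow_minus_one n"
    using gh n by (metis reflect_poly_mult reflect_xpow_minus_one)
  have "(g * gp) * H = Polynomial.smult (- coeff h 0 * inverse (coeff h 0)) ((g * reflect_poly h) * (h * reflect_poly g))"
    by (simp only: gp ph H_def mult_smult_left mult_smult_right smult_smult)
  also have "- coeff h 0 * inverse (coeff h 0) = -1" using h0 by simp
  also have "(g * reflect_poly h) * (h * reflect_poly g) = (g * h) * (reflect_poly g * reflect_poly h)"
    by (simp only: mult_ac)
  also have "Polynomial.smult (- 1) \<dots> = xpow_minus_one n * xpow_minus_one n"
    unfolding refl gh smult_minus_left smult_1_left mult_minus_right minus_minus ..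
  also have "\<dots> = xpow_minus_one (2 * n)"
  proof -
    have *: "- a = a" for a :: "'a poly"
    proof -
      have "coeff a i + coeff a i = 0" for i
        using arg_cong[OF char, of "\<lambda>x. coeff a i * x"]
        by (simp only: distrib_left mult_1_right mult_zero_right)
      then have "a + a = 0" unfolding poly_eq_iff coeff_add coeff_0 by blast
      then show ?thesis by (simp add: add_eq_0_iff)
    qed
    have "(y - 1) * (y - 1) = y * y + (- y - y) + 1" for y :: "'a poly"
      by (simp only: left_diff_distrib right_diff_distrib mult_1 mult_1_right) simp
    then have "xpow_minus_one n * xpow_minus_one n = monom 1 (2 * n) + (- monom 1 n - monom 1 n) + (1 :: 'a poly)"
      by (simp only: mult_monom mult_2 mult_1)
    also have "- monom 1 n - monom 1 n = (0 :: 'a poly)" by (subst *) simp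
    also have "monom 1 (2 * n) + 0 + 1 = monom 1 (2 * n) + - (1 :: 'a poly)" by (subst *) simp
    finally show ?thesis by simp
  qed
  finally have H: "(g * gp) * H = xpow_minus_one (2 * n)" .
  then show "g * gp dvd xpow_minus_one (2 * n)" by (metis dvd_triv_left)
  \<comment> \<open>The reflected cofactor is -h(0) r(h) g, so \<open>a\<close> must turn -h(0) into
    1/h(0).\<close>
  define a where "a = - (inverse (coeff h 0 ^ 2))"
  have "a \<noteq> 0" using h0 by (simp add: a_def)
  moreover have "Polynomial.smult a (reflect_poly H) = g * gp"
  proof -
    have "reflect_poly H = Polynomial.smult (- coeff h 0) (reflect_poly h * g)"
      by (simp only: H_def reflect_poly_smult reflect_poly_mult reflect_poly_reflect_poly[OF g0])
    moreover have "a * - coeff h 0 = inverse (coeff h 0)"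
      using h0 by (simp add: a_def power2_eq_square)
    ultimately show ?thesis by (simp only: smult_smult gp ph mult_smult_right mult.commute[of g])
  qed
  ultimately show "self_dual (2 * n) (cyclic_code_of (2 * n) (g * gp))"
    unfolding self_dual_def using dual_cyclic_code_of[OF H, of a] n by simp
qed

section \<open>Weights of vectors with vanishing power moments\<close>

text \<open>At a point z of \<open>X\<close> its value is \<open>c z\<close> times a nonzero
  product, while its top coefficients are governed by the power sums of \<open>c\<close>. Vanishing
  power sums thus lower the degree without creating zeros on \<open>X\<close>.\<close>

definition lagrange :: "'b :: field set \<Rightarrow> ('b \<Rightarrow> 'b) \<Rightarrow> 'b poly" where
  "lagrange X c = (\<Sum>x\<in>X. Polynomial.smult (c x) (\<Prod>y\<in>X - {x}. [:- y, 1:]))"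

lemma poly_lagrange:
  assumes "finite X" "z \<in> X"
  shows "poly (lagrange X c) z = c z * (\<Prod>y\<in>X - {z}. z - y)"
proof -
  have "poly (\<Prod>y\<in>X - {x}. [:- y, 1:]) z = 0" if "x \<in> X - {z}" for x
    unfolding poly_prod using that assms by (intro prod_zero) auto
  then have "(\<Sum>x\<in>X - {z}. poly (Polynomial.smult (c x) (\<Prod>y\<in>X - {x}. [:- y, 1:])) z) = 0"
    by (intro sum.neutral) (auto simp del: poly_prod)
  then show ?thesis
    unfolding lagrange_def sum.remove[OF assms] poly_add poly_sum by (simp add: poly_prod)
qed

lemma poly_lagrange_neq_0:
  "finite X \<Longrightarrow> z \<in> X \<Longrightarrow> c z \<noteq> 0 \<Longrightarrow> poly (lagrange X c) z \<noteq> 0"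
  by (simp add: poly_lagrange)

text \<open>Synthetic division expresses coefficient j of a partial product by coefficient j + 1
  times x, plus a term independent of x. Each use consumes one vanishing moment, until the index
  exceeds the degree card X - 1.\<close>

lemma coeff_lagrange_eq_0:
  assumes X: "finite X" and van: "\<And>i. i < L \<Longrightarrow> (\<Sum>x\<in>X. c x * x ^ i) = 0" and j: "card X \<le> j + L"
  shows "coeff (lagrange X c) j = 0"
proof -
  define R where "R x = (\<Prod>y\<in>X - {x}. [:- y, 1:])" for x
  define P where "P = (\<Prod>y\<in>X. [:- y, 1:])"
  have rec: "coeff (R x) j = coeff P (Suc j) + x * coeff (R x) (Suc j)" if "x \<in> X" for x j
  proof -
    have "P = [:- x, 1:] * R x" unfolding P_def R_def using X that by (rule prod.remove)
    then show ?thesis by simp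
  qed
  \<comment> \<open>The additional power \<open>x ^ i\<close> absorbs the factors x that the
    recurrence produces.\<close>
  have *: "(\<Sum>x\<in>X. c x * x ^ i * coeff (R x) j) = 0" if "card X \<le> j + d" "i + d \<le> L" for d i j
    using that
  proof (induction d arbitrary: i j)
    case 0
    have "coeff (R x) j = 0" if "x \<in> X" for x
    proof (rule coeff_eq_0)
      have "degree (R x) \<le> sum (degree \<circ> (\<lambda>y. [:- y, 1:])) (X - {x})"
        unfolding R_def using X by (rule degree_prod_sum_le[OF finite_Diff])
      also have "\<dots> = card X - 1" using that X by simp
      also have "\<dots> < j" using 0 that X card_gt_0_iff[of X] by auto
      finally show "degree (R x) < j" .
    qed
    then show ?case by simp
  next
    case (Suc d)
    have "(\<Sum>x\<in>X. c x * x ^ i * coeff (R x) j)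
      = (\<Sum>x\<in>X. (c x * x ^ i) * coeff P (Suc j) + c x * x ^ Suc i * coeff (R x) (Suc j))"
    proof (rule sum.cong[OF refl])
      fix x assume "x \<in> X"
      show "c x * x ^ i * coeff (R x) j = (c x * x ^ i) * coeff P (Suc j) + c x * x ^ Suc i * coeff (R x) (Suc j)"
        unfolding rec[OF \<open>x \<in> X\<close>, of j] by (simp add: algebra_simps)
    qed
    also have "\<dots> = (\<Sum>x\<in>X. c x * x ^ i) * coeff P (Suc j) + (\<Sum>x\<in>X. c x * x ^ Suc i * coeff (R x) (Suc j))"
      by (simp only: sum.distrib sum_distrib_right)
    also have "\<dots> = 0" using Suc.IH[of "Suc j" "Suc i"] Suc.prems van[of i] by simp
    finally show ?case .
  qed
  show ?thesis using *[of j L 0] j by (simp add: lagrange_def coeff_sum R_def)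
qed

text \<open>With at least \<open>card X\<close> vanishing moments all coefficients of the Lagrange
  polynomial would vanish, although it is nonzero on \<open>X\<close>. This is the Vandermonde
  argument behind the BCH bound.\<close>

lemma vanishing_moments_card_gt:
  fixes c :: "'b :: field \<Rightarrow> 'b"
  assumes X: "finite X" "X \<noteq> {}" and c: "\<And>x. x \<in> X \<Longrightarrow> c x \<noteq> 0"
    and van: "\<And>i. i < L \<Longrightarrow> (\<Sum>x\<in>X. c x * x ^ i) = 0"
  shows "L < card X"
proof (rule ccontr)
  assume "\<not> L < card X"
  then have "lagrange X c = 0"
    unfolding poly_eq_iff using coeff_lagrange_eq_0[OF X(1) van] by simp
  moreover obtain z where "z \<in> X" using X by auto
  ultimately show False using poly_lagrange_neq_0[of X z c] X c by auto
qed

lemma poly_map_poly_frobenius: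
  fixes p :: "'b :: comm_ring_1 poly"
  assumes "r > 0" and frob: "\<And>a b :: 'b. (a + b) ^ r = a ^ r + b ^ r"
  shows "poly (map_poly (\<lambda>a. a ^ r) p) (x ^ r) = poly p x ^ r"
  using assms by (induction p) (auto simp: map_poly_pCons zero_power power_mult_distrib)

lemma coeff_pcompose_monom:
  fixes p :: "'b :: comm_ring_1 poly"
  assumes "r > 0"
  shows "coeff (pcompose p (monom 1 r)) k = (if r dvd k then coeff p (k div r) else 0)"
proof (induction p arbitrary: k)
  case (pCons a p)
  have "coeff (pcompose (pCons a p) (monom 1 r)) k
    = (if k = 0 then a else 0) + (if k < r then 0 else coeff (pcompose p (monom 1 r)) (k - r))"
    by (simp add: pcompose_pCons coeff_monom_mult coeff_pCons split: nat.split)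
  also have "\<dots> = (if r dvd k then coeff (pCons a p) (k div r) else 0)"
    using assms by (auto simp: pCons.IH coeff_pCons dvd_minus_self le_div_geq split: nat.splits)
  finally show ?case .
qed simp

text \<open>By Lagrange interpolation, the two runs of vanishing moments yield polynomials \<open>p1\<close>, \<open>p2\<close> of degree at
  most \<open>t = card X - L - 1\<close> with \<open>x\<^sup>Q p1(x) = p2(x)\<close> on \<open>X\<close>. Raising this to the \<open>r\<close>-th power turns
  \<open>x\<^sup>Q\<close> into \<open>x\<close>. The resulting polynomial \<open>x p1'(x\<^sup>r) - p2'(x\<^sup>r)\<close> cannot be zero, because its two parts
  have exponents in different residue classes modulo \<open>r\<close>.\<close>

lemma two_runs_card_bound:
  fixes c :: "'b :: field \<Rightarrow> 'b"
  assumes X: "finite X" "X \<noteq> {}" and c: "\<And>x. x \<in> X \<Longrightarrow> c x \<noteq> 0"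
    and r: "r > 1" and frob: "\<And>a b :: 'b. (a + b) ^ r = a ^ r + b ^ r"
    and Q: "\<And>x. x \<in> X \<Longrightarrow> (x ^ Q) ^ r = x"
    and van1: "\<And>i. i < L \<Longrightarrow> (\<Sum>x\<in>X. c x * x ^ i) = 0"
    and van2: "\<And>i. i < L \<Longrightarrow> (\<Sum>x\<in>X. c x * x ^ (Q + i)) = 0"
  shows "card X \<le> (card X - L - 1) * r + 1"
proof -
  define t where "t = card X - L - 1"
  have "L < card X" by (rule vanishing_moments_card_gt[of X c, OF X c van1])
  then have tL: "card X = L + 1 + t" by (simp add: t_def)
  define p1 where "p1 = lagrange X c"
  define p2 where "p2 = lagrange X (\<lambda>x. c x * x ^ Q)"
  have deg: "degree p1 \<le> t" "degree p2 \<le> t"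
    unfolding p1_def p2_def using van1 van2 tL
    by (intro degree_le allI impI coeff_lagrange_eq_0[OF X(1), where L = L]; simp add: power_add mult.assoc)+
  have rel: "z ^ Q * poly p1 z = poly p2 z" if "z \<in> X" for z
    using X that by (simp add: p1_def p2_def poly_lagrange)
  obtain z where "z \<in> X" using X by auto
  then have p1: "p1 \<noteq> 0" using poly_lagrange_neq_0[of X z c] X c by (auto simp: p1_def)
  \<comment> \<open>\<open>G p\<close> is built so that its value at x is p(x)^r.\<close>
  define G where "G p = pcompose (map_poly (\<lambda>a. a ^ r) p) (monom 1 r)" for p :: "'b poly"
  have coeff_G: "coeff (G p) k = (if r dvd k then coeff p (k div r) ^ r else 0)" for p k
    unfolding G_def using r by (simp add: coeff_pcompose_monom coeff_map_poly)
  have deg_G: "degree (G p) \<le> t * r" if "degree p \<le> t" for p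
  proof -
    have "degree (G p) \<le> degree (map_poly (\<lambda>a. a ^ r) p) * degree (monom (1 :: 'b) r)"
      unfolding G_def by (rule degree_pcompose_le)
    also have "\<dots> \<le> t * r"
    proof -
      have "degree (map_poly (\<lambda>a. a ^ r) p) \<le> t"
        by (rule degree_le) (use that r in \<open>auto simp: coeff_map_poly coeff_eq_0\<close>)
      then show ?thesis by (simp add: degree_monom_eq)
    qed
    finally show ?thesis .
  qed
  define F where "F = pCons 0 (G p1) - G p2"
  \<comment> \<open>This exponent is 1 modulo \<open>r\<close>, so \<open>G p2\<close> contributes
    nothing to it.\<close>
  have "coeff F (Suc (r * degree p1)) = lead_coeff p1 ^ r"
  proof -
    have "\<not> r dvd Suc (r * degree p1)" using r by (simp add: dvd_eq_mod_eq_0 mod_Suc)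
    then show ?thesis using r by (simp add: F_def coeff_G)
  qed
  then have F: "F \<noteq> 0" using p1 by auto
  have "degree F \<le> t * r + 1"
    unfolding F_def using deg_G[OF deg(1)] deg_G[OF deg(2)] degree_pCons_le[of 0 "G p1"]
    by (intro degree_diff_le) auto
  moreover have "X \<subseteq> {x. poly F x = 0}"
  proof
    fix x assume x: "x \<in> X"
    have G: "poly (G p) x = poly p x ^ r" for p
      unfolding G_def using r frob by (simp add: poly_pcompose poly_monom poly_map_poly_frobenius)
    have "poly (G p2) x = x * poly (G p1) x"
      unfolding G rel[OF x, symmetric] using Q[OF x] by (simp add: power_mult_distrib)
    then show "x \<in> {x. poly F x = 0}" by (simp add: F_def)
  qed
  ultimately show ?thesis
    using card_mono[OF poly_roots_finite[OF F], of X] card_poly_roots_bound[OF F] by (simp add: t_def)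
qed

section \<open>Exponents outside the negated cyclotomic cosets\<close>

lemma not_dvd_between:
  fixes n v :: nat
  assumes "(0 < v \<and> v < n) \<or> (n < v \<and> v < 2 * n)"
  shows "\<not> n dvd v"
proof
  assume "n dvd v"
  then obtain k where "v = n * k" by (elim dvdE)
  then show False using assms by (cases k rule: nat.exhaust; cases "k - 1") auto
qed

text \<open>The critical case \<open>k = M\<close> of the next lemma, with \<open>p = q\<^bsup>M-1\<^esup>\<close> and \<open>a = a1 p + a0\<close>; then
  \<open>a q\<^sup>k\<close> is congruent to \<open>a1 + a0 q\<^sup>M\<close> modulo \<open>n\<close>. The offset \<open>e\<close> records that for \<open>M = 2\<close>
  (that is, \<open>m = 3\<close>) the run of admissible \<open>i\<close> is longer by one.\<close>

lemma not_dvd_middle_shift: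
  fixes p q a0 a1 i s n e :: nat
  assumes q: "q \<ge> 4" and p: "p \<ge> q" and n: "n + 1 = q * p * p"
    and a: "a1 * p + a0 + 2 * q \<le> q * p" and a0: "a0 < p" and a_pos: "0 < a1 + a0"
    and s: "s \<le> 1" and i: "i + q \<le> q * p + e" and e: "e \<le> 1" "e = 1 \<longrightarrow> p = q"
  shows "\<not> n dvd (i + s * (q * p) + a1 + a0 * (q * p))"
proof (rule not_dvd_between)
  let ?v = "i + s * (q * p) + a1 + a0 * (q * p)"
  have v: "?v = i + a1 + (a0 + s) * (q * p)" by (simp add: algebra_simps)
  have a1: "a1 < q"
  proof (rule ccontr)
    assume "\<not> a1 < q"
    then have "q * p \<le> a1 * p" by (intro mult_le_mono1) simp
    then show False using a q by linarith
  qed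
  have qp: "q * p \<ge> 16" using mult_le_mono[OF q order_trans[OF q p]] by simp
  have nn: "n + 1 = (q * p) * p" using n by simp
  \<comment> \<open>\<open>n + 1\<close> consists of p blocks of size q p, so comparing a0 + s with
    p locates \<open>?v\<close>. In the last case it exceeds \<open>n\<close> by less than
    \<open>n\<close>.\<close>
  consider "a0 + s + 2 \<le> p" | "a0 + s + 1 = p" | "a0 + s = p" using a0 s by linarith
  then show "(0 < ?v \<and> ?v < n) \<or> (n < ?v \<and> ?v < 2 * n)"
  proof cases
    case 1
    have "(a0 + s + 2) * (q * p) \<le> n + 1" using mult_le_mono2[OF 1, of "q * p"] nn by (simp add: mult.commute)
    then have "(a0 + s) * (q * p) + 2 * (q * p) \<le> n + 1" by (simp only: add_mult_distrib)
    then have "?v < n" unfolding v using i e a1 qp by linarith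
    moreover have "0 < ?v" using a_pos p q by auto
    ultimately show ?thesis by blast
  next
    case 2
    have "(a0 + s) * (q * p) + q * p = n + 1"
      using arg_cong[OF 2, of "\<lambda>x. x * (q * p)"] nn by (simp add: add_mult_distrib mult.commute)
    \<comment> \<open>Here \<open>?v\<close> starts from the last block below n + 1, and the bound
      on \<open>i\<close> leaves exactly this much room for \<open>a1\<close>. As a0 is at least p -
      2, assumption \<open>a\<close> supplies it.\<close>
    moreover have "a1 + e + 2 \<le> q"
    proof -
      have "a1 * p + p + 2 * q \<le> q * p + 2" using a 2 s by linarith
      then have 3: "(a1 + 1) * p + 2 * q \<le> q * p + 2" by (simp add: add_mult_distrib)
      have 4: "a1 + 2 \<le> q"
      proof (rule ccontr)
        assume "\<not> a1 + 2 \<le> q"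
        then have "q * p \<le> (a1 + 1) * p" by (intro mult_le_mono1) simp
        then show False using 3 q by linarith
      qed
      have "a1 + 3 \<le> q" if "e = 1"
      proof (rule ccontr)
        assume "\<not> a1 + 3 \<le> q"
        then have "q * p \<le> (a1 + 2) * p" by (intro mult_le_mono1) simp
        moreover have "(a1 + 2) * p = (a1 + 1) * p + p" by (simp add: add_mult_distrib)
        ultimately show False using 3 q e that by simp
      qed
      then show ?thesis using 4 e by (cases "e = 1") auto
    qed
    ultimately have "?v < n" unfolding v using i by linarith
    moreover have "0 < ?v" using a_pos p q by auto
    ultimately show ?thesis by blast
  next
    case 3
    have "?v = i + a1 + (n + 1)" unfolding v 3 using nn by (simp add: mult.commute)
    moreover have "i + a1 + 1 < n"
    proof -
      have "q * p * 4 \<le> n + 1" unfolding nn by (rule mult_le_mono2) (use p q in simp)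
      then show ?thesis using i e a1 qp by linarith
    qed
    ultimately show ?thesis by auto
  qed
qed

text \<open>Modulo n = q^m - 1 with m = 2 M - 1, multiplication by q^k rotates base-q digits, which
  makes the sum comparable with \<open>n\<close>. It shows that the negatives of i and of q^M + i
  avoid the exponents a q^k of the zeros of the BCH generator.\<close>

lemma not_dvd_shift:
  fixes q M k a i s n e :: nat
  assumes q: "q \<ge> 4" and M: "M \<ge> 2" and n: "n + 1 = q ^ (2 * M - 1)" and k: "k < 2 * M - 1"
    and a: "0 < a" "a + 2 * q \<le> q ^ M"
    and s: "s \<le> 1" and i: "i + q \<le> q ^ M + e" and e: "e \<le> 1" "e = 1 \<longrightarrow> M = 2"
  shows "\<not> n dvd (i + s * q ^ M + a * q ^ k)"
proof -
  define p where "p = q ^ (M - 1)"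
  have QM: "q ^ M = q * p"
    using power_minus_mult[of M q] M unfolding p_def by (simp add: mult.commute)
  have pq: "p \<ge> q" unfolding p_def using M q self_le_power[of q "M - 1"] by simp
  have n': "n + 1 = q * p * p"
  proof -
    have "2 * M - 1 = Suc ((M - 1) + (M - 1))" using M by simp
    then show ?thesis unfolding n by (simp only: power_Suc power_add p_def mult.assoc)
  qed
  have qp: "q * p \<ge> 16" using mult_le_mono[OF q order_trans[OF q pq]] by simp
  have sQ: "s * q ^ M \<le> q ^ M" using s by (cases s) auto
  consider "k \<le> M - 1" | "k = M" | "k > M" by linarith
  then show ?thesis
  proof cases
    case 1
    have "q ^ k \<le> p" unfolding p_def using 1 q by (intro power_increasing) auto
    then have "a * q ^ k \<le> a * p" by simp
    moreover have "a * p + 2 * (q * p) \<le> n + 1"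
      using mult_le_mono1[OF a(2), of p] unfolding n' QM by (simp add: algebra_simps)
    ultimately have "i + s * q ^ M + a * q ^ k < n" using sQ i e q unfolding QM by linarith
    then show ?thesis using a q by (intro not_dvd_between) auto
  next
    case 2
    define a1 a0 where "a1 = a div p" and "a0 = a mod p"
    have ap: "a = a1 * p + a0" by (simp add: a1_def a0_def)
    have p0: "p > 0" using pq q by simp
    have "a0 < p" using p0 by (simp add: a0_def)
    moreover have "0 < a1 + a0" using a(1) ap by (intro Nat.gr0I) simp
    moreover have "e = 1 \<longrightarrow> p = q" using e(2) by (auto simp: p_def)
    ultimately have "\<not> n dvd (i + s * (q * p) + a1 + a0 * (q * p))"
      using a(2) i e(1) s unfolding ap QM by (intro not_dvd_middle_shift[OF q pq n'])
    moreover have "i + s * q ^ M + a * q ^ k = (i + s * (q * p) + a1 + a0 * (q * p)) + n * a1"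
    proof -
      have "a * q ^ k = a1 * (n + 1) + a0 * (q * p)" unfolding 2 QM n' by (subst ap) (simp add: algebra_simps)
      then show ?thesis unfolding QM by (simp add: algebra_simps)
    qed
    ultimately show ?thesis by (simp only: dvd_add_left_iff[OF dvd_triv_left] not_False_eq_True)
  next
    case 3
    \<comment> \<open>The lowest \<open>u\<close> digits of \<open>a\<close> move up by k places,
      and the part above them, \<open>a1\<close>, wraps around to the bottom.\<close>
    define u where "u = 2 * M - 1 - k"
    have u: "u + 2 \<le> M" "k + u = 2 * M - 1" using 3 k by (auto simp: u_def)
    define a1 a0 where "a1 = a div q ^ u" and "a0 = a mod q ^ u"
    have au: "a = a1 * q ^ u + a0" unfolding a1_def a0_def by (rule div_mult_mod_eq[symmetric])
    have qu: "q ^ u > 0" using q by simp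
    have nk: "n + 1 = q ^ k * q ^ u" using n u by (metis power_add)
    have "(a0 + 1) * q ^ k \<le> n + 1"
    proof -
      have "a0 + 1 \<le> q ^ u" using mod_less_divisor[OF qu, of a] by (simp add: a0_def)
      then show ?thesis unfolding nk by (metis mult.commute mult_le_mono2)
    qed
    moreover have "4 * (q * p) \<le> q ^ k"
    proof -
      have "4 * (q * p) \<le> q * (q * p)" using q by simp
      also have "\<dots> = q ^ Suc M" by (simp add: QM)
      also have "\<dots> \<le> q ^ k" using 3 q by (intro power_increasing) auto
      finally show ?thesis .
    qed
    moreover have "a1 \<le> q * p" using a unfolding QM a1_def by (meson add_leD1 div_le_dividend order_trans)
    ultimately have less: "i + s * q ^ M + a1 + a0 * q ^ k < n"
      using i e(1) sQ qp q unfolding QM add_mult_distrib by linarith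
    have pos: "0 < a1 + a0 * q ^ k"
      using a(1) au q by (cases "a0 = 0") auto
    have "\<not> n dvd (i + s * q ^ M + a1 + a0 * q ^ k)"
      using less pos by (intro not_dvd_between) auto
    moreover have "i + s * q ^ M + a * q ^ k = (i + s * q ^ M + a1 + a0 * q ^ k) + n * a1"
    proof -
      have "a * q ^ k = a1 * (n + 1) + a0 * q ^ k" unfolding nk by (subst au) (simp add: algebra_simps)
      then show ?thesis by (simp add: algebra_simps)
    qed
    ultimately show ?thesis by (simp only: dvd_add_left_iff[OF dvd_triv_left] not_False_eq_True)
  qed
qed

section \<open>Minimal polynomials over a subfield of even order\<close>

text \<open>Multiplication by a nonzero x permutes the nonzero elements; compare their
  products.\<close>

lemma finite_field_power_card:
  fixes x :: "'a :: {field, finite}"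
  shows "x ^ card (UNIV :: 'a set) = x"
proof (cases "x = 0")
  case False
  have pos: "card (UNIV :: 'a set) > 0" by (simp add: card_gt_0_iff)
  have "(\<Prod>y\<in>UNIV - {0}. x * y) = (\<Prod>y\<in>UNIV - {0}. y)"
    by (rule prod.reindex_bij_witness[of _ "\<lambda>y. y / x" "\<lambda>y. x * y"]) (use False in auto)
  then have "x ^ (card (UNIV :: 'a set) - 1) * \<Prod>(UNIV - {0}) = 1 * \<Prod>(UNIV - {0 :: 'a})"
    by (simp add: prod.distrib)
  moreover have "\<Prod>(UNIV - {0 :: 'a}) \<noteq> 0" by simp
  ultimately have "x ^ (card (UNIV :: 'a set) - 1) = 1" by (metis mult_right_cancel)
  then show ?thesis using power_minus_mult[OF pos, of x] by simp
qed (simp add: card_gt_0_iff)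

lemma one_plus_one_eq_0:
  assumes "even (card (UNIV :: 'a :: {field, finite} set))"
  shows "(1 :: 'a) + 1 = 0"
proof -
  have "(-1 :: 'a) = (-1) ^ card (UNIV :: 'a set)" by (rule finite_field_power_card[symmetric])
  also have "\<dots> = 1" using assms by simp
  finally show ?thesis by (metis add.left_inverse)
qed

lemma add_power_two_power:
  fixes a b :: "'a :: comm_ring_1"
  assumes "(1 :: 'a) + 1 = 0"
  shows "(a + b) ^ 2 ^ k = a ^ 2 ^ k + b ^ 2 ^ k"
proof (induction k)
  case (Suc k)
  have sq: "(x + y) * (x + y) = x * x + y * y" for x y :: 'a
  proof -
    have "(x + y) * (x + y) = x * x + y * y + (1 + 1) * (x * y)" by (simp add: algebra_simps)
    then show ?thesis using assms by simp
  qed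
  show ?case by (simp add: power_mult Suc mult.commute[of 2] power2_eq_square sq)
qed simp

locale even_field_extension =
  fixes emb :: "'a :: {field, finite} \<Rightarrow> 'b :: {field, finite}" and q s m :: nat
  assumes field_hom_emb: "field_hom emb"
    and card_a: "card (UNIV :: 'a set) = q" and card_b: "card (UNIV :: 'b set) = q ^ m"
    and q_eq: "q = 2 ^ s" and s_pos: "s > 0" and m_pos: "m > 0"
begin

sublocale emb: field_hom emb by (rule field_hom_emb)
sublocale map_emb: map_poly_inj_idom_hom emb ..

lemma q_ge_2: "q \<ge> 2" using q_eq s_pos self_le_power[of 2 s] by simp

lemma char_a: "(1 :: 'a) + 1 = 0"
  by (rule one_plus_one_eq_0) (use card_a q_eq s_pos in simp)

lemma char_b: "(1 :: 'b) + 1 = 0"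
  by (rule one_plus_one_eq_0) (use card_b q_eq s_pos m_pos in simp)

lemma frobenius_add: "((x :: 'b) + y) ^ q ^ k = x ^ q ^ k + y ^ q ^ k"
  using add_power_two_power[OF char_b, of x y "s * k"] by (simp add: q_eq power_mult)

lemma power_card_b: "(x :: 'b) ^ q ^ m = x"
  using finite_field_power_card[of x] card_b by simp

text \<open>The image consists of roots of y^q - y, and this polynomial has at most \<open>q\<close>
  roots.\<close>

lemma range_emb: "range emb = {y. y ^ q = y}"
proof (rule card_subset_eq)
  show "range emb \<subseteq> {y. y ^ q = y}"
    using finite_field_power_card[where ?'a = 'a] card_a by (auto simp flip: emb.hom_power)
  define F :: "'b poly" where "F = monom 1 q - monom 1 1"
  have "coeff F q = 1" using q_ge_2 by (simp add: F_def)
  then have F: "F \<noteq> 0" by auto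
  have "degree F \<le> q" unfolding F_def using q_ge_2 by (intro degree_diff_le) (simp_all add: degree_monom_eq)
  moreover have "{y. y ^ q = y} = {y. poly F y = 0}" by (simp add: F_def poly_monom)
  ultimately have "card {y :: 'b. y ^ q = y} \<le> q" using card_poly_roots_bound[OF F] by simp
  moreover have "card (range emb) = q" using card_a by (simp add: card_image emb.inj_f)
  moreover have "card (range emb) \<le> card {y :: 'b. y ^ q = y}"
    using \<open>range emb \<subseteq> _\<close> by (intro card_mono) auto
  ultimately show "card (range emb) = card {y :: 'b. y ^ q = y}" by simp
qed simp

text \<open>Frobenius permutes the factors cyclically because the q^m-th power is the identity, so
  the coefficients are fixed by it and lie in the subfield.\<close>

lemma conjugates_poly:
  obtains r where "map_poly emb r = (\<Prod>k<m. [:- (\<gamma> ^ q ^ k), 1:])"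
proof -
  let ?r = "\<Prod>k<m. [:- (\<gamma> ^ q ^ k), 1:]"
  interpret frob: comm_ring_hom "\<lambda>x :: 'b. x ^ q"
    using frobenius_add[of _ _ 1] q_ge_2 by unfold_locales (auto simp: power_mult_distrib)
  interpret map_frob: map_poly_comm_ring_hom "\<lambda>x :: 'b. x ^ q" ..
  have "map_poly (\<lambda>x. x ^ q) ?r = (\<Prod>k<m. [:- (\<gamma> ^ q ^ Suc k), 1:])"
    by (simp add: map_frob.hom_prod map_poly_pCons frob.hom_uminus mult.commute[of q] flip: power_mult)
  also have "\<dots> = ?r"
  proof -
    have "[:- (\<gamma> ^ q ^ 0), 1:] * (\<Prod>k<m. [:- (\<gamma> ^ q ^ Suc k), 1:]) = (\<Prod>k<Suc m. [:- (\<gamma> ^ q ^ k), 1:])"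
      by (rule prod.lessThan_Suc_shift[symmetric])
    also have "\<dots> = ?r * [:- (\<gamma> ^ q ^ m), 1:]" by (rule prod.lessThan_Suc)
    finally show ?thesis by (simp only: power_card_b power_0 power_one_right mult.commute[of ?r] mult_cancel_left) simp
  qed
  finally have fixed: "coeff ?r i ^ q = coeff ?r i" for i
    using frob.coeff_map_poly_hom by metis
  then have "coeff ?r i \<in> range emb" for i unfolding range_emb by simp
  then have "map_poly emb (map_poly (the_inv emb) ?r) = ?r"
    \<comment> \<open>\<open>map_poly\<close> acts coefficientwise only for a function that maps 0
      to 0.\<close>
    using the_inv_f_f[OF emb.inj_f, of 0]
    by (intro poly_eqI) (simp add: coeff_map_poly f_the_inv_into_f[OF emb.inj_f])
  then show ?thesis by (rule that)
qed

text \<open>The product of the conjugates provides an annihilating polynomial. Two monic ones of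
  least degree coincide, since their difference would have smaller degree; so the \<open>THE\<close>
  is well defined.\<close>

lemma minimal_poly_spec:
  "lead_coeff (minimal_poly emb x) = 1" "poly (map_poly emb (minimal_poly emb x)) x = 0"
  "r \<noteq> 0 \<Longrightarrow> poly (map_poly emb r) x = 0 \<Longrightarrow> degree (minimal_poly emb x) \<le> degree r"
proof -
  let ?A = "\<lambda>r. r \<noteq> 0 \<and> poly (map_poly emb r) x = 0"
  let ?P = "\<lambda>p. lead_coeff p = 1 \<and> poly (map_poly emb p) x = 0 \<and>
     (\<forall>r. ?A r \<longrightarrow> degree p \<le> degree r)"
  obtain r0 where r0: "map_poly emb r0 = (\<Prod>k<m. [:- (x ^ q ^ k), 1:])" by (rule conjugates_poly)
  have "?A r0"
  proof
    have "map_poly emb r0 \<noteq> 0" unfolding r0 by (simp add: prod_zero_iff)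
    then show "r0 \<noteq> 0" by auto
    have "poly [:- (x ^ q ^ 0), 1:] x = 0" by simp
    then show "poly (map_poly emb r0) x = 0"
      unfolding r0 poly_prod using m_pos by (intro prod_zero) (auto intro!: bexI[of _ 0])
  qed
  then obtain p where p: "?A p" "\<And>r. ?A r \<Longrightarrow> degree p \<le> degree r"
    using ex_has_least_nat[of ?A r0 degree] by blast
  have "?P (Polynomial.smult (inverse (lead_coeff p)) p)"
    using p by (simp add: emb.map_poly_hom_smult)
  moreover have "p1 = p2" if "?P p1" "?P p2" for p1 p2
  proof (rule ccontr)
    assume "p1 \<noteq> p2"
    have nz: "p1 \<noteq> 0" "p2 \<noteq> 0" using that by auto
    have eq: "degree p1 = degree p2" using that nz by (meson antisym)
    have "?A (p1 - p2)" using that \<open>p1 \<noteq> p2\<close> by (simp add: map_emb.hom_minus)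
    then have le: "degree p1 \<le> degree (p1 - p2)" using that by blast
    have "coeff (p1 - p2) (degree p1) = 0" using that eq by simp
    moreover have "degree (p1 - p2) \<le> degree p1" using eq by (intro degree_diff_le) auto
    ultimately have "lead_coeff (p1 - p2) = 0" using le by (metis antisym)
    then show False using \<open>p1 \<noteq> p2\<close> by (simp del: coeff_diff)
  qed
  ultimately have "\<exists>!p. ?P p" by blast
  then have spec: "?P (minimal_poly emb x)" unfolding minimal_poly_def by (rule theI')
  show "lead_coeff (minimal_poly emb x) = 1" by (rule conjunct1[OF spec])
  show "poly (map_poly emb (minimal_poly emb x)) x = 0" by (rule conjunct1[OF conjunct2[OF spec]])
  show "degree (minimal_poly emb x) \<le> degree r" if "r \<noteq> 0" "poly (map_poly emb r) x = 0"
    using conjunct2[OF conjunct2[OF spec]] that by blast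
qed

lemma minimal_poly_dvd_iff: "minimal_poly emb x dvd p \<longleftrightarrow> poly (map_poly emb p) x = 0"
proof
  assume "minimal_poly emb x dvd p"
  then show "poly (map_poly emb p) x = 0"
    using minimal_poly_spec(2)[of x] by (auto simp: map_emb.hom_mult elim!: dvdE)
next
  let ?M = "minimal_poly emb x"
  assume *: "poly (map_poly emb p) x = 0"
  have M: "?M \<noteq> 0" using minimal_poly_spec(1)[of x] by auto
  have "p mod ?M = p - ?M * (p div ?M)" by (simp add: minus_mult_div_eq_mod)
  then have "poly (map_poly emb (p mod ?M)) x = 0"
    using * minimal_poly_spec(2)[of x] by (simp add: map_emb.hom_minus map_emb.hom_mult)
  then have "p mod ?M = 0"
    using minimal_poly_spec(3)[of "p mod ?M" x] degree_mod_less'[OF M, of p] by fastforce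
  then show "?M dvd p" by (simp only: dvd_eq_mod_eq_0)
qed

end

lemma Lcm_field_poly_monic:
  fixes A :: "'a :: field_gcd poly set"
  assumes "Lcm A \<noteq> 0"
  shows "lead_coeff (Lcm A) = 1"
proof -
  have "normalize (Lcm A) = Lcm A" by simp
  then have "unit_factor (Lcm A) = 1"
    using assms by (metis normalize_mult_unit_factor mult_cancel_left1 mult.commute unit_factor_mult_normalize mult_cancel_right1)
  then have "unit_factor (lead_coeff (Lcm A)) = 1"
    by (simp add: unit_factor_poly_def monom_0 one_pCons)
  moreover have "is_unit (lead_coeff (Lcm A))" using assms by (simp add: dvd_field_iff)
  ultimately show ?thesis by (simp add: is_unit_unit_factor)
qed

lemma map_poly_reflect_poly:
  fixes f :: "'a :: field \<Rightarrow> 'b :: field"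
  assumes "field_hom f"
  shows "map_poly f (reflect_poly p) = reflect_poly (map_poly f p)"
proof -
  interpret field_hom f by (rule assms)
  show ?thesis by (intro poly_eqI) (simp add: coeff_reflect_poly)
qed

section \<open>The primitive narrow-sense BCH code and its dual\<close>

text \<open>\<open>D\<close> stands for delta - 1, the number of prescribed consecutive
  zeros.\<close>

locale primitive_bch = even_field_extension emb q s m
  for emb :: "'a :: {field_gcd, finite} \<Rightarrow> 'b :: {field, finite}" and q s m :: nat +
  fixes n D :: nat and \<beta> :: 'b and G :: "'a poly"
  assumes n_eq: "n = q ^ m - 1" and prim: "is_primitive_root n \<beta>"
    and G_eq: "G = Lcm ((\<lambda>i. minimal_poly emb (\<beta> ^ i)) ` {1..D})"
begin

lemma n_pos: "n > 0" using prim by (simp add: is_primitive_root_def)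

lemma Suc_n: "n + 1 = q ^ m" using n_eq n_pos by simp

lemma beta_pow_eq_1_iff: "\<beta> ^ k = 1 \<longleftrightarrow> n dvd k"
proof
  assume *: "\<beta> ^ k = 1"
  have "\<beta> ^ k = \<beta> ^ (n * (k div n)) * \<beta> ^ (k mod n)" by (simp flip: power_add)
  then have "\<beta> ^ (k mod n) = 1" using * prim by (simp add: power_mult is_primitive_root_def)
  moreover have "k mod n < n" using n_pos by simp
  ultimately have "k mod n = 0" using prim by (auto simp: is_primitive_root_def)
  then show "n dvd k" by (simp add: dvd_eq_mod_eq_0)
next
  assume "n dvd k"
  then show "\<beta> ^ k = 1" using prim by (auto simp: is_primitive_root_def power_mult elim!: dvdE)
qed

lemma beta_nz: "\<beta> \<noteq> 0" using prim by (auto simp: is_primitive_root_def power_0_left)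

lemma beta_inj: "inj_on (\<lambda>j. \<beta> ^ j) {..<n}"
proof -
  have *: "i = j" if "\<beta> ^ i = \<beta> ^ j" "i \<le> j" "j < n" for i j
  proof -
    have "\<beta> ^ j = \<beta> ^ (i + (j - i))" using that by simp
    then have "\<beta> ^ j = \<beta> ^ i * \<beta> ^ (j - i)" by (simp only: power_add)
    then have "\<beta> ^ (j - i) = 1" using that beta_nz by simp
    then have "n dvd j - i" by (simp add: beta_pow_eq_1_iff)
    then show ?thesis using that by (auto dest: dvd_imp_le)
  qed
  show ?thesis
  proof (rule inj_onI)
    fix i j assume "i \<in> {..<n}" "j \<in> {..<n}" "\<beta> ^ i = \<beta> ^ j"
    then show "i = j" using *[of i j] *[of j i] by (cases "i \<le> j") auto
  qed
qed

lemma poly_xpow_minus_one: "poly (map_poly emb (xpow_minus_one n)) z = z ^ n - 1"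
  by (simp add: map_emb.hom_minus emb.map_poly_hom_monom poly_monom)

lemma G_dvd_iff: "G dvd p \<longleftrightarrow> (\<forall>i\<in>{1..D}. poly (map_poly emb p) (\<beta> ^ i) = 0)"
  unfolding G_eq Lcm_dvd_iff by (simp add: minimal_poly_dvd_iff)

lemma G_dvd: "G dvd xpow_minus_one n"
  unfolding G_dvd_iff poly_xpow_minus_one by (simp add: beta_pow_eq_1_iff flip: power_mult)

lemma G_nz: "G \<noteq> 0" using G_dvd xpow_minus_one_neq_0[OF n_pos] by auto

lemma G_monic: "lead_coeff G = 1"
  unfolding G_eq by (rule Lcm_field_poly_monic) (use G_nz in \<open>simp add: G_eq\<close>)

lemma root_of_dvd: "p dvd r \<Longrightarrow> poly (map_poly emb p) z = 0 \<Longrightarrow> poly (map_poly emb r) z = 0"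
  by (auto simp: map_emb.hom_mult elim!: dvdE)

text \<open>The product of the conjugate polynomials of beta^1, ..., beta^D vanishes at these
  points, so \<open>G\<close> divides it and has no other zeros than the conjugates.\<close>

lemma G_root:
  assumes "poly (map_poly emb G) z = 0"
  obtains a k where "a \<in> {1..D}" "k < m" "z = \<beta> ^ (a * q ^ k)"
proof -
  have "\<exists>r. map_poly emb r = (\<Prod>k<m. [:- ((\<beta> ^ a) ^ q ^ k), 1:])" for a
    using conjugates_poly[of "\<beta> ^ a"] by metis
  then obtain r where r: "\<And>a. map_poly emb (r a) = (\<Prod>k<m. [:- ((\<beta> ^ a) ^ q ^ k), 1:])" by metis
  have root: "poly (map_poly emb (r a)) y = 0 \<longleftrightarrow> (\<exists>k<m. y = \<beta> ^ (a * q ^ k))" for a y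
    unfolding r poly_prod by (auto simp: prod_zero_iff power_mult)
  have "G dvd (\<Prod>a\<in>{1..D}. r a)"
    unfolding G_dvd_iff
  proof
    fix i assume i: "i \<in> {1..D}"
    have "poly (map_poly emb (r i)) (\<beta> ^ i) = 0" unfolding root using m_pos by (auto intro!: exI[of _ 0])
    moreover have "r i dvd (\<Prod>a\<in>{1..D}. r a)" using i by (intro dvd_prodI) auto
    ultimately show "poly (map_poly emb (\<Prod>a\<in>{1..D}. r a)) (\<beta> ^ i) = 0" using root_of_dvd by blast
  qed
  from root_of_dvd[OF this assms] have "\<exists>a\<in>{1..D}. poly (map_poly emb (r a)) z = 0"
    by (simp add: map_emb.hom_prod poly_prod prod_zero_iff)
  then show ?thesis using that root by blast
qed

text \<open>The reflections of \<open>G\<close> and \<open>h\<close> multiply to -(x^n - 1). If the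
  reflection of \<open>h\<close> is nonzero at beta^i, then beta^(-i) is a zero of \<open>G\<close>,
  so -i is congruent to some a q^k modulo n.\<close>

lemma reflect_cofactor_root:
  assumes Gh: "G * h = xpow_minus_one n"
    and i: "\<And>a k. a \<in> {1..D} \<Longrightarrow> k < m \<Longrightarrow> \<not> n dvd (i + a * q ^ k)"
  shows "poly (map_poly emb (reflect_poly h)) (\<beta> ^ i) = 0"
proof (rule ccontr)
  assume nz: "\<not> ?thesis"
  have "reflect_poly G * reflect_poly h = - xpow_minus_one n"
    using Gh n_pos by (metis reflect_poly_mult reflect_xpow_minus_one)
  then have "poly (map_poly emb (reflect_poly G * reflect_poly h)) (\<beta> ^ i)
      = - poly (map_poly emb (xpow_minus_one n)) (\<beta> ^ i)"
    by (simp only: map_emb.hom_uminus poly_minus)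
  also have "\<dots> = 0" unfolding poly_xpow_minus_one by (simp add: beta_pow_eq_1_iff flip: power_mult)
  finally have "poly (map_poly emb (reflect_poly G)) (\<beta> ^ i) = 0"
    using nz by (simp add: map_emb.hom_mult)
  then have "poly (map_poly emb G) (inverse (\<beta> ^ i)) = 0"
    using beta_nz by (simp add: map_poly_reflect_poly[OF field_hom_emb] poly_reflect_poly_nz)
  then obtain a k where ak: "a \<in> {1..D}" "k < m" "inverse (\<beta> ^ i) = \<beta> ^ (a * q ^ k)" by (rule G_root)
  then have "\<beta> ^ (i + a * q ^ k) = 1" using beta_nz by (simp add: power_add flip: ak(3))
  then show False using i[OF ak(1,2)] by (simp add: beta_pow_eq_1_iff)
qed

text \<open>\<open>X\<close> collects the locators beta^j of the nonzero positions and
  \<open>w\<close> the entries there. Evaluating the word at beta^i becomes the i-th power moment,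
  which connects zeros to weights.\<close>

lemma codeword_moments:
  assumes c: "c \<in> carrier_vec n"
  obtains X w where "finite X" "card X = weight c" "\<And>x. x \<in> X \<Longrightarrow> w x \<noteq> 0" "0 \<notin> X"
    "\<And>i. poly (map_poly emb (vec_poly c)) (\<beta> ^ i) = (\<Sum>x\<in>X. w x * x ^ i)"
proof -
  define S where "S = {j. j < n \<and> c $ j \<noteq> 0}"
  define f where "f = (\<lambda>j. \<beta> ^ j)"
  have inj: "inj_on f S" unfolding f_def by (rule inj_on_subset[OF beta_inj]) (auto simp: S_def)
  define w where "w x = emb (c $ the_inv_into S f x)" for x
  have w: "w (f j) = emb (c $ j)" if "j \<in> S" for j
    unfolding w_def using the_inv_into_f_f[OF inj that] by simp
  have deg: "degree (vec_poly c) < n" using degree_vec_poly[of c] c n_pos by auto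
  have "poly (map_poly emb (vec_poly c)) (\<beta> ^ i) = (\<Sum>x\<in>f ` S. w x * x ^ i)" for i
  proof -
    have "poly (map_poly emb (vec_poly c)) (\<beta> ^ i)
        = (\<Sum>j\<le>degree (vec_poly c). emb (coeff (vec_poly c) j) * (\<beta> ^ i) ^ j)"
      by (simp add: poly_altdef)
    also have "\<dots> = (\<Sum>j<n. emb (coeff (vec_poly c) j) * (\<beta> ^ i) ^ j)"
      using deg by (intro sum.mono_neutral_left) (auto simp: coeff_eq_0 simp del: coeff_vec_poly)
    also have "\<dots> = (\<Sum>j\<in>S. emb (c $ j) * (\<beta> ^ i) ^ j)"
      using c by (intro sum.mono_neutral_cong_right) (auto simp: S_def)
    also have "\<dots> = (\<Sum>j\<in>S. w (f j) * f j ^ i)"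
      by (intro sum.cong) (simp_all add: w[unfolded f_def] f_def mult.commute flip: power_mult)
    also have "\<dots> = (\<Sum>x\<in>f ` S. w x * x ^ i)" using inj by (simp add: sum.reindex)
    finally show ?thesis .
  qed
  moreover have "card (f ` S) = weight c" using c inj by (simp add: card_image S_def weight_def)
  moreover have "w x \<noteq> 0" if "x \<in> f ` S" for x using that by (auto simp: w) (simp add: S_def)
  moreover have "0 \<notin> f ` S" using beta_nz by (auto simp: f_def)
  ultimately show ?thesis by (intro that[of "f ` S" w]) (auto simp: S_def)
qed

lemma weight_pos: "c \<in> carrier_vec n \<Longrightarrow> c \<noteq> 0\<^sub>v n \<Longrightarrow> weight c > 0"
  by (auto simp: weight_def card_gt_0_iff intro!: eq_vecI)

lemma bch_bound:
  assumes c: "c \<in> cyclic_code_of n G" "c \<noteq> 0\<^sub>v n"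
  shows "D < weight c"
proof -
  have cc: "c \<in> carrier_vec n" "G dvd vec_poly c" using c mem_cyclic_code_of_iff[OF G_dvd] by auto
  obtain X w where X: "finite X" "card X = weight c" "\<And>x. x \<in> X \<Longrightarrow> w x \<noteq> 0" "0 \<notin> X"
    "\<And>i. poly (map_poly emb (vec_poly c)) (\<beta> ^ i) = (\<Sum>x\<in>X. w x * x ^ i)"
    using codeword_moments[OF cc(1)] by metis
  have "D < card X"
  \<comment> \<open>The run of zeros starts at exponent 1, so one factor x is moved into the
    weights, which stay nonzero as 0 is not in \<open>X\<close>.\<close>
  proof (rule vanishing_moments_card_gt[of X "\<lambda>x. w x * x"])
    show "X \<noteq> {}" using X(2) weight_pos[OF cc(1) c(2)] by auto
    show "(\<Sum>x\<in>X. w x * x * x ^ i) = 0" if "i < D" for i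
    proof -
      have "Suc i \<in> {1..D}" using that by simp
      then have "poly (map_poly emb (vec_poly c)) (\<beta> ^ Suc i) = 0" using cc(2) G_dvd_iff by blast
      then show ?thesis unfolding X(5) by (simp add: mult.assoc)
    qed
  qed (use X in auto)
  then show ?thesis by (simp add: X(2))
qed

lemma two_runs_bound:
  assumes c: "c \<in> carrier_vec n" "c \<noteq> 0\<^sub>v n" and M: "m = M + M - 1" "M \<ge> 2"
    and roots: "\<And>i. i < L \<Longrightarrow> poly (map_poly emb (vec_poly c)) (\<beta> ^ i) = 0"
      "\<And>i. i < L \<Longrightarrow> poly (map_poly emb (vec_poly c)) (\<beta> ^ (q ^ M + i)) = 0"
  shows "L < weight c" "weight c \<le> (weight c - L - 1) * q ^ (M - 1) + 1"
proof -
  obtain X w where X: "finite X" "card X = weight c" "\<And>x. x \<in> X \<Longrightarrow> w x \<noteq> 0" "0 \<notin> X"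
    "\<And>i. poly (map_poly emb (vec_poly c)) (\<beta> ^ i) = (\<Sum>x\<in>X. w x * x ^ i)"
    using codeword_moments[OF c(1)] by metis
  have "X \<noteq> {}" using X(2) weight_pos[OF c] by auto
  then have "L < card X"
    using X roots by (intro vanishing_moments_card_gt[of X w]) auto
  then show "L < weight c" by (simp add: X(2))
  have "card X \<le> (card X - L - 1) * q ^ (M - 1) + 1"
  proof (rule two_runs_card_bound[where c = w and Q = "q ^ M"])
    show "X \<noteq> {}" by fact
    show "q ^ (M - 1) > 1" using q_ge_2 M by (intro one_less_power) auto
    show "(x ^ q ^ M) ^ q ^ (M - 1) = x" for x :: 'b
      using power_card_b[of x] M by (simp flip: power_mult power_add)
  qed (use X roots frobenius_add in auto)
  then show "weight c \<le> (weight c - L - 1) * q ^ (M - 1) + 1" by (simp add: X(2))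
qed

end

section \<open>Zeros and minimum weight of the dual code\<close>

context primitive_bch
begin

text \<open>With M = (m+1)/2 and D = delta - 1, assumption \<open>D\<close> is the formula for
  delta. \<open>e\<close> is the extra length of the two runs of zeros, possible only for M =
  2.\<close>

context
  fixes M e :: nat and h gp :: "'a poly"
  assumes m: "m = 2 * M - 1" and M: "M \<ge> 2" and q4: "q \<ge> 4" and D: "D + 2 * q = q ^ M"
    and e: "e \<le> 1" "e = 1 \<longrightarrow> M = 2"
    and Gh: "G * h = xpow_minus_one n"
    and gp: "gp = Polynomial.smult (inverse (poly h 0)) (reflect_poly h)"
begin

lemma coeff_h_0: "poly h 0 \<noteq> 0"
  using coeff_0_cofactor(2)[OF Gh n_pos] by (simp add: poly_0_coeff_0)

lemma gp_dvd: "gp dvd xpow_minus_one n"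
  unfolding gp using coeff_h_0 reflect_cofactor_dvd[OF Gh n_pos] by (simp add: smult_dvd_iff)

lemma degree_gp: "degree gp = degree h"
  unfolding gp using coeff_h_0 by (simp add: poly_0_coeff_0)

lemma degree_G_add: "degree G + degree gp = n"
proof -
  have "h \<noteq> 0" using coeff_h_0 by auto
  then show ?thesis
    using degree_mult_eq[OF G_nz, of h] Gh degree_xpow_minus_one[of n, where ?'a = 'a] by (simp add: degree_gp)
qed

lemma gp_monic: "lead_coeff gp = 1"
  unfolding degree_gp using coeff_h_0
  by (simp add: gp coeff_reflect_poly poly_0_coeff_0)

lemma gp_root:
  assumes j: "j \<le> 1" and i: "i + q \<le> q ^ M + e"
  shows "poly (map_poly emb gp) (\<beta> ^ (i + j * q ^ M)) = 0"
proof -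
  have "poly (map_poly emb (reflect_poly h)) (\<beta> ^ (i + j * q ^ M)) = 0"
  proof (rule reflect_cofactor_root[OF Gh])
    fix a k assume "a \<in> {1..D}" "k < m"
    then show "\<not> n dvd (i + j * q ^ M + a * q ^ k)"
      using not_dvd_shift[OF q4 M _ _ _ _ j i e] Suc_n m D by auto
  qed
  then show ?thesis by (simp add: gp emb.map_poly_hom_smult)
qed

text \<open>The exponents up to D = q^M - 2q lie in the run of zeros starting at 0. This is the
  inclusion of the dual code in the code.\<close>

lemma G_dvd_gp: "G dvd gp"
  unfolding G_dvd_iff
proof
  fix i assume "i \<in> {1..D}"
  then show "poly (map_poly emb gp) (\<beta> ^ i) = 0" using gp_root[of 0 i] D by simp
qed

lemma dual_weight_bound:
  assumes c: "c \<in> cyclic_code_of n gp" "c \<noteq> 0\<^sub>v n"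
  shows "q ^ M + e + 3 \<le> weight c"
proof -
  have cc: "c \<in> carrier_vec n" "gp dvd vec_poly c" using c mem_cyclic_code_of_iff[OF gp_dvd] by auto
  \<comment> \<open>The run is i = 0, ..., q^M + e - q, hence the + 1.\<close>
  define L where "L = q ^ M + e + 1 - q"
  define p where "p = q ^ (M - 1)"
  have Qp: "q ^ M = q * p"
    using power_minus_mult[of M q] M unfolding p_def by (simp add: mult.commute)
  have pq: "p \<ge> q" unfolding p_def using M q4 self_le_power[of q "M - 1"] by simp
  have L: "L + q = q ^ M + e + 1" unfolding L_def using D by simp
  have m': "m = M + M - 1" using m by simp
  have r: "poly (map_poly emb (vec_poly c)) (\<beta> ^ i) = 0"
    "poly (map_poly emb (vec_poly c)) (\<beta> ^ (q ^ M + i)) = 0" if "i < L" for i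
    using root_of_dvd[OF cc(2)] gp_root[of 0 i] gp_root[of 1 i] that L by (simp_all add: add.commute)
  note bounds = two_runs_bound[where L = L, OF cc(1) c(2) m' M r, folded p_def]
  define t where "t = weight c - L - 1"
  have w: "weight c = L + 1 + t" using bounds(1) by (simp add: t_def)
  have "weight c \<le> t * p + 1" using bounds(2) by (simp add: t_def)
  have "q < t"
  proof (rule ccontr)
    assume "\<not> q < t"
    then consider "t = q" | "t + 1 \<le> q" by linarith
    then show False
    proof cases
      case 1
      \<comment> \<open>The weight would be q^M + e + 2, above q p + 1.\<close>
      then show False using \<open>weight c \<le> t * p + 1\<close> w L Qp by simp
    next
      case 2
      \<comment> \<open>Now t p + 1 is at most q p - p + 1, which is below L + 1 because p is at
        least q.\<close>
      then have "(t + 1) * p \<le> q * p" by (rule mult_le_mono1)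
      then have "t * p + p \<le> q * p" by simp
      then show False using \<open>weight c \<le> t * p + 1\<close> w L Qp pq by linarith
    qed
  qed
  then show ?thesis using w L by linarith
qed

end

end

section \<open>Self-duality, parameters and distance bounds of the code of length 2n\<close>

theorem theorem3:
  fixes emb :: "'a :: {field_gcd, finite} \<Rightarrow> 'b :: {field, finite}"
    and q s m n :: nat and \<delta> :: int and \<beta> :: 'b
    and C C' :: "'a vec set" and g h gperp :: "'a poly"
  assumes "field_hom emb"
    and "card (UNIV :: 'a set) = q" and "card (UNIV :: 'b set) = q ^ m"
    and "q = 2 ^ s" and "s \<ge> 2" and "odd m"
    and "n = q ^ m - 1" and "is_primitive_root n \<beta>"
    and "\<delta> = int q ^ ((m + 1) div 2) - 2 * int q + 1" and "\<delta> \<ge> 2"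
    and "C = bch_code emb n \<delta> 1 \<beta>"
    and "g = generator_poly n C"
    and "h = xpow_minus_one n div g"
    and "gperp = Polynomial.smult (inverse (poly h 0)) (reflect_poly h)"
    and "C' = cyclic_code_of (2 * n) (g * gperp)"
  shows "is_generator_poly n (dual_code n C) gperp \<and>
    is_generator_poly (2 * n) C' (g * gperp) \<and>
    cyclic_code (2 * n) C' \<and> self_dual (2 * n) C' \<and>
    (\<exists>d. linear_code (2 * n) n d C' \<and>
      (m \<ge> 5 \<longrightarrow>
        d = min (2 * min_dist C) (min_dist (dual_code n C)) \<and>
        d \<ge> q ^ ((m + 1) div 2) + 3) \<and>
      (q \<ge> 8 \<and> m = 3 \<longrightarrow>
        d = min (2 * min_dist C) (min_dist (dual_code n C)) \<and>
        d \<ge> q ^ 2 + 4))"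
proof -
  define M where "M = (m + 1) div 2"
  have m: "m = 2 * M - 1" and m_pos: "m > 0"
    using \<open>odd m\<close> by (auto simp: M_def odd_pos elim!: oddE)
  have q4: "q \<ge> 4"
    using power_increasing[OF \<open>s \<ge> 2\<close>, of "2 :: nat"] \<open>q = 2 ^ s\<close> by simp
  define D where "D = nat (\<delta> - 1)"
  have \<delta>: "\<delta> = int D + 1" and D_pos: "D \<ge> 1" using \<open>\<delta> \<ge> 2\<close> by (auto simp: D_def)
  have D: "D + 2 * q = q ^ M"
  proof -
    have "int (D + 2 * q) = int (q ^ M)"
      using \<open>\<delta> = int q ^ ((m + 1) div 2) - 2 * int q + 1\<close> unfolding \<delta> M_def[symmetric] by simp
    then show ?thesis by (simp only: of_nat_eq_iff)
  qed
  \<comment> \<open>For m = 1 the formula gives delta = 1 - q, contrary to delta >= 2.\<close>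
  have M: "M \<ge> 2"
  proof (rule ccontr)
    assume "\<not> M \<ge> 2"
    then have "M = 1" using m m_pos by (cases M) auto
    then show False using D q4 by simp
  qed
  define G where "G = Lcm ((\<lambda>i. minimal_poly emb (\<beta> ^ i)) ` {1..D})"
  interpret primitive_bch emb q s m n D \<beta> G
  proof (intro primitive_bch.intro even_field_extension.intro primitive_bch_axioms.intro)
    show "s > 0" using \<open>s \<ge> 2\<close> by simp
  qed (fact assms m_pos G_def)+
  have C: "C = cyclic_code_of n G"
  proof -
    have "{1..1 + \<delta> - 2} = int ` {1..D}" unfolding \<delta> by (simp add: image_int_atLeastAtMost)
    then show ?thesis
      unfolding \<open>C = bch_code emb n \<delta> 1 \<beta>\<close> bch_code_def G_def by (simp add: image_image)
  qed
  have g: "g = G"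
    unfolding \<open>g = generator_poly n C\<close> C
    by (rule generator_poly_eqI[OF is_generator_poly_cyclic_code_of[OF n_pos G_monic G_dvd]])
  have Gh: "G * h = xpow_minus_one n"
    unfolding \<open>h = xpow_minus_one n div g\<close> g using G_dvd by simp
  note gp_eq = \<open>gperp = Polynomial.smult (inverse (poly h 0)) (reflect_poly h)\<close>
  \<comment> \<open>This choice treats both cases at once: for m = 3 it supplies the additional 1 in
    the bound.\<close>
  define e :: nat where "e = (if M = 2 then 1 else 0)"
  have e: "e \<le> 1" "e = 1 \<longrightarrow> M = 2" by (auto simp: e_def)
  note ctx = m M q4 D e Gh gp_eq
  note gp_monic = gp_monic[OF ctx] and gp_dvd = gp_dvd[OF ctx] and G_dvd_gp = G_dvd_gp[OF ctx]
  have dual: "dual_code n C = cyclic_code_of n gperp"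
    unfolding C gp_eq using coeff_h_0[OF ctx] by (intro dual_cyclic_code_of[OF Gh n_pos]) simp
  have 1: "is_generator_poly n (dual_code n C) gperp"
    unfolding dual by (rule is_generator_poly_cyclic_code_of[OF n_pos gp_monic gp_dvd])
  note sd = self_dual_doubled_code[OF char_a n_pos Gh gp_eq]
  note C' = \<open>C' = cyclic_code_of (2 * n) (g * gperp)\<close>[unfolded g]
  have n2: "2 * n > 0" using n_pos by simp
  have monic: "lead_coeff (G * gperp) = 1" by (simp only: lead_coeff_mult G_monic gp_monic mult_1)
  have 2: "is_generator_poly (2 * n) C' (g * gperp)"
    unfolding g C' by (rule is_generator_poly_cyclic_code_of[OF n2 monic sd(1)])
  have gp_nz: "gperp \<noteq> 0" using gp_monic by auto
  have deg: "degree (G * gperp) = n"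
    using degree_G_add[OF ctx] by (simp add: degree_mult_eq[OF G_nz gp_nz])
  \<comment> \<open>\<open>G\<close> has the zero beta, so it is not constant; hence the dual is not
    the zero code and its minimum distance is meaningful.\<close>
  have deg_G: "degree G > 0"
  proof (rule ccontr)
    assume "\<not> degree G > 0"
    then have "G = 1" using G_monic by (simp add: monic_degree_0)
    moreover have "G dvd 1 \<Longrightarrow> poly (map_poly emb 1) (\<beta> ^ 1) = 0"
      using D_pos unfolding G_dvd_iff by auto
    ultimately show False by simp
  qed
  have deg_gp: "degree gperp < n" using degree_G_add[OF ctx] deg_G by simp
  have deg_G': "degree G < n" using dvd_imp_degree_le[OF G_dvd_gp gp_nz] deg_gp by simp
  have odd_n: "odd n" using Suc_n \<open>q = 2 ^ s\<close> \<open>s \<ge> 2\<close> m_pos by (metis even_plus_one_iff even_power even_numeral less_le_trans zero_less_numeral gr_implies_not0)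
  have min: "min_dist C' = min (2 * min_dist C) (min_dist (dual_code n C))"
    unfolding dual unfolding C C' by (rule min_dist_doubled_code[OF char_a odd_n G_dvd_gp gp_dvd deg_gp sd(1)])
  have dC: "D < min_dist C"
    unfolding C using cyclic_code_of_nontrivial[OF G_dvd deg_G'] bch_bound
      min_dist_attained[OF cyclic_code_of_carrier cyclic_code_of_diff[OF G_dvd] cyclic_code_of_zero[OF G_dvd]]
    by metis
  have dD: "q ^ M + e + 3 \<le> min_dist (dual_code n C)"
    unfolding dual using cyclic_code_of_nontrivial[OF gp_dvd deg_gp] dual_weight_bound[OF ctx]
      min_dist_attained[OF cyclic_code_of_carrier cyclic_code_of_diff[OF gp_dvd] cyclic_code_of_zero[OF gp_dvd]]
    by metis
  have lin: "linear_code (2 * n) n (min_dist C') C'"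
    unfolding linear_code_def C' using subspace_cyclic_code_of[OF sd(1)] dim_cyclic_code_of[OF sd(1) n2] deg by simp
  have b5: "q ^ ((m + 1) div 2) + 3 \<le> min_dist C'" if "m \<ge> 5"
  proof -
    \<comment> \<open>From q^M >= 16 q, twice the BCH bound, 2 (q^M - 2q + 1), exceeds q^M +
      3.\<close>
    have "q * 4 * 4 \<le> q * q * q" using q4 by (intro mult_le_mono) auto
    also have "\<dots> = q ^ 3" by (simp add: power3_eq_cube)
    also have "\<dots> \<le> q ^ M" using m that q4 by (intro power_increasing) auto
    finally have "q * 16 \<le> q ^ M" by simp
    then show ?thesis unfolding min M_def[symmetric] using dC dD D q4 by linarith
  qed
  have b3: "q ^ 2 + 4 \<le> min_dist C'" if "q \<ge> 8" "m = 3"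
  proof -
    have M2: "M = 2" using that m by simp
    then have "e = 1" by (simp add: e_def)
    \<comment> \<open>This makes 2 (q^2 - 2q + 1) at least q^2 + 4, while e = 1 gives q^2 + 4 for
      the dual.\<close>
    moreover have "q * 8 \<le> q ^ 2" using that unfolding power2_eq_square by (intro mult_le_mono) auto
    ultimately show ?thesis unfolding min using dC dD D that unfolding M2 by linarith
  qed
  have "cyclic_code (2 * n) C'" using 2 by (simp add: is_generator_poly_def)
  moreover have "self_dual (2 * n) C'" unfolding C' by (rule sd(2))
  ultimately show ?thesis using 1 2 lin min b5 b3 by blast
qed

end
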